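(* Let $\mathcal V$ be a variety (of finite signature, with a c.e. set of equational laws) such that the class $\mathcal V_{f.g.}$ of finitely generated c.e. algebras in $\mathcal V$ has the ascending chain condition on congruence lattices. Then $\cong_{\mathcal V_{f.g.}}\ \le_c\ =^{ce}$.
   Context: $W_e$ denotes the $e$-th c.e. set and $\langle\cdot,\cdot\rangle$ a computable pairing function. A variety $\mathcal V$ is the class of all algebras in a fixed algebraic signature (function symbols only, constants allowed) satisfying a fixed c.e. set of equational laws; for finitely generated classes the signature is finite. For $k\ge1$ let $X_k=\{x_0,\dots,x_{k-1}\}$ and fix a computable bijective coding of pairs of terms over $X_k$ by natural numbers. For a set $R$ of such pairs, $\langle X_k\mid R\rangle_{\mathcal V}$ is the term algebra $\mathcal T(X_k)$ modulo the smallest congruence containing $R$ and all instances of the laws of $\mathcal V$. The class $\mathcal V_{f.g.}$ consists of the algebras $\mathcal V_{f.g.}[\langle k,e\rangle]=\langle X_k\mid W_e\rangle_{\mathcal V}$ ($k\ge1$, $e\in\mathbb N$), and $\cong_{\mathcal V_{f.g.}}$ is the equivalence relation on codes given by $\langle k,e\rangle\cong_{\mathcal V_{f.g.}}\langle j,i\rangle$ iff $\mathcal V_{f.g.}[\langle k,e\rangle]\cong\mathcal V_{f.g.}[\langle j,i\rangle]$. A class has the ascending chain condition (ACC) if for every algebra in it, every ascending chain of congruences $\theta_0\subseteq\theta_1\subseteq\cdots$ is eventually constant. The relation $=^{ce}$ on $\mathbb N$ is: $e=^{ce}i$ iff $W_e=W_i$. For equivalence relations $E,F$ on $\mathbb N$,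 $E\le_c F$ means there is a total computable $h$ with $x\,E\,y\iff h(x)\,F\,h(y)$ for all $x,y$. *)

theory Defs
  imports Main "HOL-Library.Nat_Bijection"
begin

section \<open>Partial recursive functions and c.e. sets\<close>

text \<open>Unary partial recursive functions; several arguments are packed with
  \<^const>\<open>prod_encode\<close>, which is the pairing function throughout.\<close>

datatype prog =
    Zero | Succ | Left | Right
  | Tup prog prog | Comp prog prog | Rec prog prog | Mu prog

inductive computes :: "prog \<Rightarrow> nat \<Rightarrow> nat \<Rightarrow> bool" where
  "computes Zero x 0"
| "computes Succ x (Suc x)"
| "computes Left x (fst (prod_decode x))"
| "computes Right x (snd (prod_decode x))"
| "computes p x y \<Longrightarrow> computes q x z \<Longrightarrow> computes (Tup p q) x (prod_encode (y, z))"
| "computes q x y \<Longrightarrow> computes p y z \<Longrightarrow> computes (Comp p q) x z"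
| "computes p x y \<Longrightarrow> computes (Rec p q) (prod_encode (x, 0)) y"
| "computes (Rec p q) (prod_encode (x, n)) y \<Longrightarrow>
   computes q (prod_encode (x, prod_encode (n, y))) z \<Longrightarrow>
   computes (Rec p q) (prod_encode (x, Suc n)) z"
| "\<forall>m<n. \<exists>y. computes p (prod_encode (x, m)) (Suc y) \<Longrightarrow>
   computes p (prod_encode (x, n)) 0 \<Longrightarrow>
   computes (Mu p) x n"

definition computable :: "(nat \<Rightarrow> nat) \<Rightarrow> bool" where
  "computable f \<longleftrightarrow> (\<exists>p. \<forall>x. computes p x (f x))"

text \<open>A bijective Goedel numbering of programs.\<close>

primrec prog_num :: "prog \<Rightarrow> nat" where
  "prog_num Zero = 0"
| "prog_num Succ = 1"
| "prog_num Left = 2"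
| "prog_num Right = 3"
| "prog_num (Tup p q) = 4 * prod_encode (prog_num p, prog_num q) + 4"
| "prog_num (Comp p q) = 4 * prod_encode (prog_num p, prog_num q) + 5"
| "prog_num (Rec p q) = 4 * prod_encode (prog_num p, prog_num q) + 6"
| "prog_num (Mu p) = 4 * prog_num p + 7"

definition W :: "nat \<Rightarrow> nat set" where
  "W e = {x. \<exists>p y. prog_num p = e \<and> computes p x y}"

definition ce :: "nat set \<Rightarrow> bool" where
  "ce A \<longleftrightarrow> (\<exists>e. A = W e)"

definition eq_ce :: "nat \<Rightarrow> nat \<Rightarrow> bool" where
  "eq_ce e i \<longleftrightarrow> W e = W i"

definition computably_reducible ::
    "(nat \<Rightarrow> nat \<Rightarrow> bool) \<Rightarrow> (nat \<Rightarrow> nat \<Rightarrow> bool) \<Rightarrow> bool" (infix "\<le>\<^sub>c" 50) where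
  "E \<le>\<^sub>c F \<longleftrightarrow> (\<exists>h. computable h \<and> (\<forall>x y. E x y \<longleftrightarrow> F (h x) (h y)))"


section \<open>Algebras\<close>

text \<open>A finite signature is the list of the arities of its function symbols, which are
  the numbers below the length of the list. The interpretation of a symbol is relevant only on
  argument lists over the carrier of the right length.\<close>

type_synonym signature = "nat list"

record 'a alg =
  carrier :: "'a set"
  interp :: "nat \<Rightarrow> 'a list \<Rightarrow> 'a"

definition args :: "signature \<Rightarrow> 'a alg \<Rightarrow> nat \<Rightarrow> 'a list set" where
  "args ar A f = {xs. length xs = ar ! f \<and> set xs \<subseteq> carrier A}"

definition isomorphic :: "signature \<Rightarrow> 'a alg \<Rightarrow> 'b alg \<Rightarrow> bool" where
  "isomorphic ar A B \<longleftrightarrow>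
     (\<exists>h. bij_betw h (carrier A) (carrier B) \<and>
          (\<forall>f<length ar. \<forall>xs\<in>args ar A f. h (interp A f xs) = interp B f (map h xs)))"

definition congruence :: "signature \<Rightarrow> 'a alg \<Rightarrow> ('a \<times> 'a) set \<Rightarrow> bool" where
  "congruence ar A \<theta> \<longleftrightarrow>
     equiv (carrier A) \<theta> \<and>
     (\<forall>f<length ar. \<forall>xs\<in>args ar A f. \<forall>ys\<in>args ar A f.
        list_all2 (\<lambda>x y. (x, y) \<in> \<theta>) xs ys \<longrightarrow> (interp A f xs, interp A f ys) \<in> \<theta>)"

text \<open>For a congruence, the representatives chosen in the second component do not matter.\<close>

definition quotient_alg :: "'a alg \<Rightarrow> ('a \<times> 'a) set \<Rightarrow> 'a set alg" where
  "quotient_alg A \<theta> =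
     \<lparr>carrier = carrier A // \<theta>,
      interp = (\<lambda>f Cs. \<theta> `` {interp A f xs | xs. list_all2 (\<in>) xs Cs})\<rparr>"

definition ACC_alg :: "signature \<Rightarrow> 'a alg \<Rightarrow> bool" where
  "ACC_alg ar A \<longleftrightarrow>
     (\<forall>\<theta> :: nat \<Rightarrow> ('a \<times> 'a) set.
        (\<forall>n. congruence ar A (\<theta> n)) \<and> (\<forall>n. \<theta> n \<subseteq> \<theta> (Suc n)) \<longrightarrow>
        (\<exists>N. \<forall>n\<ge>N. \<theta> n = \<theta> N))"


section \<open>Terms\<close>

datatype tm = Var nat | App nat "tm list"

inductive wf_tm :: "signature \<Rightarrow> nat set \<Rightarrow> tm \<Rightarrow> bool" for ar X where
  "i \<in> X \<Longrightarrow> wf_tm ar X (Var i)"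
| "f < length ar \<Longrightarrow> length ts = ar ! f \<Longrightarrow> \<forall>t\<in>set ts. wf_tm ar X t \<Longrightarrow> wf_tm ar X (App f ts)"

primrec subst :: "(nat \<Rightarrow> tm) \<Rightarrow> tm \<Rightarrow> tm" where
  "subst \<sigma> (Var i) = \<sigma> i"
| "subst \<sigma> (App f ts) = App f (map (subst \<sigma>) ts)"

primrec tm_num :: "tm \<Rightarrow> nat" where
  "tm_num (Var i) = prod_encode (0, i)"
| "tm_num (App f ts) = prod_encode (Suc f, list_encode (map tm_num ts))"

definition tm_pair_num :: "tm \<times> tm \<Rightarrow> nat" where
  "tm_pair_num = (\<lambda>(s, t). prod_encode (tm_num s, tm_num t))"

definition terms :: "signature \<Rightarrow> nat \<Rightarrow> tm set" where
  "terms ar k = {t. wf_tm ar {..<k} t}"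

definition term_alg :: "signature \<Rightarrow> nat \<Rightarrow> tm alg" where
  "term_alg ar k = \<lparr>carrier = terms ar k, interp = App\<rparr>"

text \<open>A computable bijective coding of the pairs of terms over $X_k$ by natural numbers,
  given by its decoding maps \<open>\<delta> k\<close>, uniformly in \<open>k\<close>.
  If the signature has no symbol of positive arity, there are only
  finitely many such pairs and injectivity is impossible; surjectivity is required in any case.\<close>

definition pair_coding :: "signature \<Rightarrow> (nat \<Rightarrow> nat \<Rightarrow> tm \<times> tm) \<Rightarrow> bool" where
  "pair_coding ar \<delta> \<longleftrightarrow>
     (\<forall>k\<ge>1. range (\<delta> k) = terms ar k \<times> terms ar k \<and>
             (infinite (terms ar k) \<longrightarrow> inj (\<delta> k))) \<and>
     (\<exists>g. computable g \<and> (\<forall>k\<ge>1. \<forall>n. g (prod_encode (k, n)) = tm_pair_num (\<delta> k n)))"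


section \<open>Varieties and their finitely generated c.e. algebras\<close>

text \<open>A variety is given by its signature \<open>ar\<close> and its set \<open>L\<close> of laws. Laws may use
  arbitrarily many variables.\<close>

definition ce_variety :: "signature \<Rightarrow> (tm \<times> tm) set \<Rightarrow> bool" where
  "ce_variety ar L \<longleftrightarrow>
     (\<forall>(s, t)\<in>L. wf_tm ar UNIV s \<and> wf_tm ar UNIV t) \<and> ce (tm_pair_num ` L)"

definition law_instances :: "signature \<Rightarrow> (tm \<times> tm) set \<Rightarrow> nat \<Rightarrow> (tm \<times> tm) set" where
  "law_instances ar L k =
     {(subst \<sigma> s, subst \<sigma> t) | \<sigma> s t. (s, t) \<in> L \<and> (\<forall>i. \<sigma> i \<in> terms ar k)}"

definition presentation_congruence ::
    "signature \<Rightarrow> (tm \<times> tm) set \<Rightarrow> nat \<Rightarrow> (tm \<times> tm) set \<Rightarrow> (tm \<times> tm) set" where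
  "presentation_congruence ar L k R =
     \<Inter>{\<theta>. congruence ar (term_alg ar k) \<theta> \<and> R \<subseteq> \<theta> \<and> law_instances ar L k \<subseteq> \<theta>}"

definition presented_alg ::
    "signature \<Rightarrow> (tm \<times> tm) set \<Rightarrow> nat \<Rightarrow> (tm \<times> tm) set \<Rightarrow> tm set alg" where
  "presented_alg ar L k R = quotient_alg (term_alg ar k) (presentation_congruence ar L k R)"

definition fg_alg ::
    "signature \<Rightarrow> (tm \<times> tm) set \<Rightarrow> (nat \<Rightarrow> nat \<Rightarrow> tm \<times> tm) \<Rightarrow> nat \<Rightarrow> nat \<Rightarrow> tm set alg" where
  "fg_alg ar L \<delta> k e = presented_alg ar L k (\<delta> k ` W e)"

text \<open>Since \<open>k \<ge> 1\<close>, the code of \<open>(k, e)\<close> uses \<open>k - 1\<close>, so that every natural number is the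
  code of exactly one such pair.\<close>

definition fg_code :: "nat \<Rightarrow> nat \<Rightarrow> nat" where
  "fg_code k e = prod_encode (k - 1, e)"

definition fg_iso ::
    "signature \<Rightarrow> (tm \<times> tm) set \<Rightarrow> (nat \<Rightarrow> nat \<Rightarrow> tm \<times> tm) \<Rightarrow> nat \<Rightarrow> nat \<Rightarrow> bool" where
  "fg_iso ar L \<delta> x y \<longleftrightarrow>
     (\<exists>k e j i. k \<ge> 1 \<and> j \<ge> 1 \<and> x = fg_code k e \<and> y = fg_code j i \<and>
        isomorphic ar (fg_alg ar L \<delta> k e) (fg_alg ar L \<delta> j i))"

definition fg_ACC :: "signature \<Rightarrow> (tm \<times> tm) set \<Rightarrow> (nat \<Rightarrow> nat \<Rightarrow> tm \<times> tm) \<Rightarrow> bool" where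
  "fg_ACC ar L \<delta> \<longleftrightarrow> (\<forall>k\<ge>1. \<forall>e. ACC_alg ar (fg_alg ar L \<delta> k e))"

end

theory Submission
  imports Defs
begin

text \<open>A code is sent to an index of the set of all finite presentations
  \<open>\<langle>X\<^sub>j | F\<rangle>\<close> such that the algebra \<open>A\<close> it names is generated by a \<open>j\<close>-tuple satisfying \<open>F\<close>,
  that is, such that \<open>A\<close> is a quotient of the algebra so presented. This set is c.e. uniformly
  in the code and depends only on the isomorphism type of \<open>A\<close>. Conversely, by ACC in the free
  algebra, \<open>A\<close> is itself finitely presented, so if \<open>A\<close> and \<open>B\<close> have the same set, there are
  surjections \<open>A \<rightarrow> B\<close> and \<open>B \<rightarrow> A\<close>. Their composite is a surjective endomorphism of \<open>A\<close>, and it is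
  injective because the kernels of its powers form an ascending chain.

  Uniform enumerability rests on one closure property: a set defined inductively by semidecidable
  rules with at most two premises is semidecidable. It is applied to the computation relation
  (a universal program), to substitution, and to equational derivability.\<close>

text \<open>Only positive facts about a c.e. algebra can be enumerated: an equation that holds is
  eventually derived, one that fails never shows. An exact presentation would also assert that no
  further equation holds, so the invariant lists the presentations of which \<open>A\<close> is
  merely a quotient. Generation by a tuple is positive too, although it quantifies over all
  elements: it suffices that each of the \<open>k\<close> given generators is provably equal to a
  term in the tuple. The price is that equal invariants yield surjections only. Both directions
  arise because a finite presentation of an algebra belongs to its own set and hence to the other
  one. The tuple found there induces a well-defined map as soon as it satisfies the finitely many
  relations, since the laws hold in both algebras. All of this is carried out on terms: a
  homomorphism is a substitution, and its kernel is a pulled-back congruence.\<close>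

abbreviation pr :: "nat \<Rightarrow> nat \<Rightarrow> nat" ("\<langle>_,/ _\<rangle>")
  where "\<langle>a, b\<rangle> \<equiv> prod_encode (a, b)"

definition p1 :: "nat \<Rightarrow> nat" where "p1 n = fst (prod_decode n)"
definition p2 :: "nat \<Rightarrow> nat" where "p2 n = snd (prod_decode n)"

lemma p1_pair [simp]: "p1 \<langle>a, b\<rangle> = a" and p2_pair [simp]: "p2 \<langle>a, b\<rangle> = b"
  by (simp_all add: p1_def p2_def)

lemma pair_collapse [simp]: "\<langle>p1 n, p2 n\<rangle> = n"
  by (simp add: p1_def p2_def)

section \<open>Closure of total computable functions under pairing, primitive recursion and list
  access\<close>

section \<open>Computable functions\<close>

text \<open>Most rules collected here carry arbitrary computable arguments inside, as in
  \<open>computable (\<lambda>x. Suc (f x))\<close>, so that repeated introduction decomposes a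
  compound expression from the outside in.\<close>

named_theorems computable_intros

lemma computable_id [computable_intros]: "computable (\<lambda>x. x)"
proof -
  have "computes (Tup Left Right) x x" for x
    using computes.intros(5)[OF computes.intros(3) computes.intros(4), of x] by simp
  then show ?thesis unfolding computable_def by blast
qed

lemma computable_comp:
  assumes "computable f" "computable g"
  shows "computable (\<lambda>x. f (g x))"
proof -
  obtain p q where "\<And>x. computes p x (f x)" "\<And>x. computes q x (g x)"
    using assms unfolding computable_def by blast
  then have "computes (Comp p q) x (f (g x))" for x
    by (meson computes.intros(6))
  then show ?thesis unfolding computable_def by blast
qed

lemma computable_Suc [computable_intros]: "computable f \<Longrightarrow> computable (\<lambda>x. Suc (f x))"
proof (rule computable_comp[of Suc f])
  show "computable Suc" unfolding computable_def using computes.intros(2) by blast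
qed

lemma computable_p1 [computable_intros]: "computable f \<Longrightarrow> computable (\<lambda>x. p1 (f x))"
proof (rule computable_comp[of p1 f])
  show "computable p1" unfolding computable_def p1_def using computes.intros(3) by blast
qed

lemma computable_p2 [computable_intros]: "computable f \<Longrightarrow> computable (\<lambda>x. p2 (f x))"
proof (rule computable_comp[of p2 f])
  show "computable p2" unfolding computable_def p2_def using computes.intros(4) by blast
qed

lemma computable_pair [computable_intros]:
  assumes "computable f" "computable g"
  shows "computable (\<lambda>x. \<langle>f x, g x\<rangle>)"
proof -
  obtain p q where "\<And>x. computes p x (f x)" "\<And>x. computes q x (g x)"
    using assms unfolding computable_def by blast
  then have "computes (Tup p q) x \<langle>f x, g x\<rangle>" for x
    by (meson computes.intros(5))
  then show ?thesis unfolding computable_def by blast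
qed

lemma computable_const [computable_intros]: "computable (\<lambda>x. c)"
proof (induction c)
  case 0
  show ?case unfolding computable_def using computes.intros(1) by blast
qed (rule computable_Suc)

text \<open>The step program of \<open>Rec\<close> reads parameter, counter and previous value
  packed as \<open>\<langle>x, \<langle>n, y\<rangle>\<rangle>\<close>, hence the form of the
  premise on \<open>g\<close>. \<open>Rec\<close> takes its bound from the input; composition with
  \<open>\<lambda>x. \<langle>x, h x\<rangle>\<close> turns the bound into any computable function
  of \<open>x\<close>.\<close>

lemma computable_rec:
  assumes f: "computable f" and g: "computable (\<lambda>z. g (p1 z) (p1 (p2 z)) (p2 (p2 z)))"
    and h: "computable h"
  shows "computable (\<lambda>x. rec_nat (f x) (g x) (h x))"
proof -
  obtain p q where p: "\<And>x. computes p x (f x)"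
    and q: "\<And>x. computes q x (g (p1 x) (p1 (p2 x)) (p2 (p2 x)))"
    using f g unfolding computable_def by blast
  have "computes (Rec p q) \<langle>x, n\<rangle> (rec_nat (f x) (g x) n)" for x n
  proof (induction n)
    case 0
    then show ?case using p by (simp add: computes.intros(7))
  next
    case (Suc n)
    show ?case
      using computes.intros(8)[OF Suc] q[of "\<langle>x, \<langle>n, rec_nat (f x) (g x) n\<rangle>\<rangle>"] by simp
  qed
  then have "computes (Rec p q) z (rec_nat (f (p1 z)) (g (p1 z)) (p2 z))" for z
    by (metis pair_collapse)
  then have "computable (\<lambda>z. rec_nat (f (p1 z)) (g (p1 z)) (p2 z))"
    unfolding computable_def by blast
  from computable_comp[OF this computable_pair[OF computable_id h]] show ?thesis by simp
qed

lemma computable_add [computable_intros]: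
  assumes "computable f" "computable g"
  shows "computable (\<lambda>x. f x + g x :: nat)"
proof -
  have "rec_nat a (\<lambda>_ y. Suc y) b = a + b" for a b by (induction b) auto
  moreover have "computable (\<lambda>x. rec_nat (f x) (\<lambda>_ y. Suc y) (g x))"
    by (rule computable_rec) (intro computable_intros assms)+
  ultimately show ?thesis by simp
qed

text \<open>The one multiplication that the numbering \<open>prog_num\<close> calls for.\<close>

lemma computable_times4 [computable_intros]:
  assumes "computable f"
  shows "computable (\<lambda>x. 4 * f x)"
proof -
  have "computable (\<lambda>x. f x + f x + (f x + f x))" by (intro computable_intros assms)
  moreover have "f x + f x + (f x + f x) = 4 * f x" for x by simp
  ultimately show ?thesis by simp
qed

lemma computable_pred [computable_intros]:
  assumes "computable f"
  shows "computable (\<lambda>x. f x - 1)"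
proof -
  have "rec_nat 0 (\<lambda>n _. n) b = b - 1" for b by (cases b) auto
  moreover have "computable (\<lambda>x. rec_nat 0 (\<lambda>n _. n) (f x))"
    by (rule computable_rec) (intro computable_intros assms)+
  ultimately show ?thesis by simp
qed

lemma computable_diff [computable_intros]:
  assumes "computable f" "computable g"
  shows "computable (\<lambda>x. f x - g x)"
proof -
  have "rec_nat a (\<lambda>_ y. y - 1) b = a - b" for a b :: nat by (induction b) auto
  moreover have "computable (\<lambda>x. rec_nat (f x) (\<lambda>_ y. y - 1) (g x))"
    by (rule computable_rec) (intro computable_intros assms)+
  ultimately show ?thesis by simp
qed

text \<open>Past the end of the list coded by \<open>l\<close> the value is 0, which is the code of \<open>Var 0\<close>.\<close>

definition entry :: "nat \<Rightarrow> nat \<Rightarrow> nat" where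
  "entry l i = p1 (rec_nat l (\<lambda>_ y. p2 (y - 1)) i - 1)"

lemma computable_entry [computable_intros]:
  assumes "computable f" "computable g"
  shows "computable (\<lambda>x. entry (f x) (g x))"
proof -
  have "computable (\<lambda>x. rec_nat (f x) (\<lambda>_ y. p2 (y - 1)) (g x))"
    by (rule computable_rec) (intro computable_intros assms)+
  then show ?thesis unfolding entry_def by (intro computable_intros)
qed

lemma entry_list_encode:
  assumes "i < length xs"
  shows "entry (list_encode xs) i = xs ! i"
proof -
  \<comment> \<open>The code 0 of the empty list is also the code of the pair of zeros, so the tail
    operation fixes the empty list.\<close>
  have "p2 0 = 0"
    using p2_pair[of 0 0] by (simp add: prod_encode_def)
  then have tail: "p2 (list_encode ys - 1) = list_encode (tl ys)" for ys
    by (cases ys) simp_all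
  have "rec_nat (list_encode xs) (\<lambda>_ y. p2 (y - 1)) n = list_encode (drop n xs)" for n
    by (induction n) (simp_all add: tail[simplified] drop_Suc tl_drop)
  moreover obtain ys where "drop i xs = xs ! i # ys"
    using assms by (metis Cons_nth_drop_Suc)
  ultimately show ?thesis by (simp add: entry_def)
qed

section \<open>Decidable relations and their projections: connectives and quantifiers\<close>

section \<open>Decidable and semidecidable predicates\<close>

text \<open>Truth is coded by 0 because \<open>Mu\<close> searches for a zero: the characteristic
  function of a decidable relation can be handed to it directly.\<close>

definition dec :: "(nat \<Rightarrow> bool) \<Rightarrow> bool" where
  "dec P \<longleftrightarrow> computable (\<lambda>x. if P x then 0 else 1)"

lemma dec_comp: "dec P \<Longrightarrow> computable f \<Longrightarrow> dec (\<lambda>x. P (f x))"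
  unfolding dec_def by (rule computable_comp)

lemma dec_zero: "computable f \<Longrightarrow> dec (\<lambda>x. f x = 0)"
proof -
  assume f: "computable f"
  have "computable (\<lambda>x. 1 - (1 - f x))" by (intro computable_intros f)
  moreover have "1 - (1 - n) = (if n = 0 then 0 else 1)" for n :: nat by auto
  ultimately show ?thesis unfolding dec_def by simp
qed

lemma dec_eq: "computable f \<Longrightarrow> computable g \<Longrightarrow> dec (\<lambda>x. f x = g x)"
proof -
  assume "computable f" "computable g"
  then have "dec (\<lambda>x. (f x - g x) + (g x - f x) = 0)" by (intro dec_zero computable_intros)
  moreover have "(a - b) + (b - a) = 0 \<longleftrightarrow> a = b" for a b :: nat by auto
  ultimately show ?thesis by simp
qed

lemma dec_less: "computable f \<Longrightarrow> computable g \<Longrightarrow> dec (\<lambda>x. f x < g x)"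
proof -
  assume "computable f" "computable g"
  then have "dec (\<lambda>x. Suc (f x) - g x = 0)" by (intro dec_zero computable_intros)
  then show ?thesis by (simp add: Suc_le_eq)
qed

lemma dec_conj:
  assumes "dec P" "dec Q"
  shows "dec (\<lambda>x. P x \<and> Q x)"
proof -
  have "dec (\<lambda>x. (if P x then 0 else 1) + (if Q x then 0 else 1 :: nat) = 0)"
    using assms unfolding dec_def[of P] dec_def[of Q] by (intro dec_zero computable_intros)
  then show ?thesis by (rule arg_cong[where f = dec, THEN iffD1, rotated]) auto
qed

lemma dec_not:
  assumes "dec P"
  shows "dec (\<lambda>x. \<not> P x)"
proof -
  have "dec (\<lambda>x. 1 - (if P x then 0 else 1 :: nat) = 0)"
    using assms unfolding dec_def[of P] by (intro dec_zero computable_intros)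
  then show ?thesis by (rule arg_cong[where f = dec, THEN iffD1, rotated]) auto
qed

lemma dec_disj:
  assumes "dec P" "dec Q"
  shows "dec (\<lambda>x. P x \<or> Q x)"
  using dec_not[OF dec_conj[OF dec_not[OF assms(1)] dec_not[OF assms(2)]]] by simp

text \<open>A sum of zeros and ones vanishes iff every summand does; the recursion adds up the truth
  values below the bound.\<close>

lemma dec_ball:
  assumes "dec (\<lambda>z. P (p1 z) (p2 z))" "computable f"
  shows "dec (\<lambda>x. \<forall>i<f x. P x i)"
proof -
  let ?c = "\<lambda>x i. if P x i then 0 else 1 :: nat"
  have "rec_nat 0 (\<lambda>n y. y + ?c x n) m = 0 \<longleftrightarrow> (\<forall>i<m. P x i)" for x m
    by (induction m) (auto simp: less_Suc_eq)
  moreover have c: "computable (\<lambda>z. ?c (p1 z) (p1 (p2 z)))"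
    using computable_comp[OF assms(1)[unfolded dec_def], of "\<lambda>z. \<langle>p1 z, p1 (p2 z)\<rangle>"]
    by (simp add: computable_intros)
  have "computable (\<lambda>x. rec_nat 0 (\<lambda>n y. y + ?c x n) (f x))"
    by (intro computable_rec computable_intros c assms(2))
  note dec_zero[OF this]
  ultimately show ?thesis by simp
qed

text \<open>Taken as projection of a decidable relation rather than as domain of a program, so that
  closure proofs only combine witnesses. The translations from and to the sets \<open>W e\<close>
  are \<open>semidec_W\<close> and \<open>semidec_W_index\<close>.\<close>

definition semidec :: "(nat \<Rightarrow> bool) \<Rightarrow> bool" where
  "semidec P \<longleftrightarrow> (\<exists>D. dec D \<and> (\<forall>x. P x \<longleftrightarrow> (\<exists>w. D \<langle>x, w\<rangle>)))"

text \<open>Serves to trade an inductive predicate for the formula in its \<open>simps\<close> rule,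
  to which the closure rules apply.\<close>

lemma semidec_cong: "(\<And>x. P x = Q x) \<Longrightarrow> semidec Q \<Longrightarrow> semidec P"
proof -
  assume "\<And>x. P x = Q x"
  then have "P = Q" by (rule ext)
  then show "semidec Q \<Longrightarrow> semidec P" by simp
qed

named_theorems semidec_intros

lemma semidecI: "dec (\<lambda>z. D (p1 z) (p2 z)) \<Longrightarrow> (\<And>x. P x \<longleftrightarrow> (\<exists>w. D x w)) \<Longrightarrow> semidec P"
  unfolding semidec_def by (rule exI[of _ "\<lambda>z. D (p1 z) (p2 z)"]) simp

lemma semidecE:
  assumes "semidec P"
  obtains D where "dec (\<lambda>z. D (p1 z) (p2 z))" "\<And>x. P x \<longleftrightarrow> (\<exists>w. D x w)"
proof -
  obtain D where "dec D" "\<forall>x. P x \<longleftrightarrow> (\<exists>w. D \<langle>x, w\<rangle>)"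
    using assms unfolding semidec_def by blast
  then show thesis using that[of "\<lambda>x w. D \<langle>x, w\<rangle>"] by simp
qed

lemma dec_comp2:
  assumes "dec (\<lambda>z. D (p1 z) (p2 z))" "computable f" "computable g"
  shows "dec (\<lambda>x. D (f x) (g x))"
  using dec_comp[OF assms(1) computable_pair[OF assms(2,3)]] by simp

lemma semidec_dec: "dec P \<Longrightarrow> semidec P"
  by (rule semidecI[where D = "\<lambda>x w. P x"]) (simp_all add: dec_comp[of P p1] computable_intros)

lemma semidec_eq [semidec_intros]:
  "computable f \<Longrightarrow> computable g \<Longrightarrow> semidec (\<lambda>x. f x = g x)"
  by (intro semidec_dec dec_eq)

lemma semidec_less [semidec_intros]:
  "computable f \<Longrightarrow> computable g \<Longrightarrow> semidec (\<lambda>x. f x < g x)"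
  by (intro semidec_dec dec_less)

lemma semidec_comp: "semidec P \<Longrightarrow> computable f \<Longrightarrow> semidec (\<lambda>x. P (f x))"
proof -
  assume f: "computable f" and "semidec P"
  then obtain D where D: "dec (\<lambda>z. D (p1 z) (p2 z))" "\<And>x. P x \<longleftrightarrow> (\<exists>w. D x w)"
    by (auto elim: semidecE)
  show ?thesis
    by (rule semidecI[where D = "\<lambda>x w. D (f x) w"])
      (intro dec_comp2[OF D(1)] computable_intros computable_comp[OF f], simp add: D(2))
qed

lemma semidec_conj [semidec_intros]:
  assumes "semidec P" "semidec Q"
  shows "semidec (\<lambda>x. P x \<and> Q x)"
proof -
  obtain D where D: "dec (\<lambda>z. D (p1 z) (p2 z))" "\<And>x. P x \<longleftrightarrow> (\<exists>w. D x w)"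
    using assms(1) by (auto elim: semidecE)
  obtain E where E: "dec (\<lambda>z. E (p1 z) (p2 z))" "\<And>x. Q x \<longleftrightarrow> (\<exists>w. E x w)"
    using assms(2) by (auto elim: semidecE)
  show ?thesis
  proof (rule semidecI[where D = "\<lambda>x w. D x (p1 w) \<and> E x (p2 w)"])
    show "dec (\<lambda>z. D (p1 z) (p1 (p2 z)) \<and> E (p1 z) (p2 (p2 z)))"
      by (intro dec_conj dec_comp2[OF D(1)] dec_comp2[OF E(1)] computable_intros)
    show "(P x \<and> Q x) = (\<exists>w. D x (p1 w) \<and> E x (p2 w))" for x
      by (metis D(2) E(2) p1_pair p2_pair)
  qed
qed

lemma semidec_disj [semidec_intros]:
  assumes "semidec P" "semidec Q"
  shows "semidec (\<lambda>x. P x \<or> Q x)"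
proof -
  obtain D where D: "dec (\<lambda>z. D (p1 z) (p2 z))" "\<And>x. P x \<longleftrightarrow> (\<exists>w. D x w)"
    using assms(1) by (auto elim: semidecE)
  obtain E where E: "dec (\<lambda>z. E (p1 z) (p2 z))" "\<And>x. Q x \<longleftrightarrow> (\<exists>w. E x w)"
    using assms(2) by (auto elim: semidecE)
  show ?thesis
    by (rule semidecI[OF dec_disj[OF D(1) E(1)]]) (auto simp: D(2) E(2))
qed

lemma semidec_ex [semidec_intros]:
  assumes "semidec (\<lambda>z. P (p1 z) (p2 z))"
  shows "semidec (\<lambda>x. \<exists>y. P x y)"
proof -
  obtain D where D: "dec (\<lambda>z. D (p1 z) (p2 z))" "\<And>x. P (p1 x) (p2 x) \<longleftrightarrow> (\<exists>w. D x w)"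
    using assms by (auto elim: semidecE)
  show ?thesis
  proof (rule semidecI[where D = "\<lambda>x w. D \<langle>x, p1 w\<rangle> (p2 w)"])
    show "dec (\<lambda>z. D \<langle>p1 z, p1 (p2 z)\<rangle> (p2 (p2 z)))"
      by (intro dec_comp2[OF D(1)] computable_intros)
    show "(\<exists>y. P x y) = (\<exists>w. D \<langle>x, p1 w\<rangle> (p2 w))" for x
      by (metis D(2) p1_pair p2_pair)
  qed
qed

text \<open>A single number has to witness all instances at once: it codes the list of their
  witnesses, read by \<open>entry\<close>.\<close>

lemma semidec_ball [semidec_intros]:
  assumes "semidec (\<lambda>z. P (p1 z) (p2 z))" "computable f"
  shows "semidec (\<lambda>x. \<forall>i<f x. P x i)"
proof -
  obtain D where D: "dec (\<lambda>z. D (p1 z) (p2 z))" "\<And>x. P (p1 x) (p2 x) \<longleftrightarrow> (\<exists>w. D x w)"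
    using assms by (auto elim: semidecE)
  have P: "P x i \<longleftrightarrow> (\<exists>w. D \<langle>x, i\<rangle> w)" for x i
    using D(2)[of "\<langle>x, i\<rangle>"] by simp
  show ?thesis
  proof (rule semidecI[where D = "\<lambda>x l. \<forall>i<f x. D \<langle>x, i\<rangle> (entry l i)"])
    show "dec (\<lambda>z. \<forall>i<f (p1 z). D \<langle>p1 z, i\<rangle> (entry (p2 z) i))"
      by (intro dec_ball dec_comp2[OF D(1)] computable_intros computable_comp[OF assms(2)])
    show "(\<forall>i<f x. P x i) = (\<exists>l. \<forall>i<f x. D \<langle>x, i\<rangle> (entry l i))" for x
    proof
      assume "\<forall>i<f x. P x i"
      then obtain w where "\<forall>i<f x. D \<langle>x, i\<rangle> (w i)" unfolding P by metis
      then have "\<forall>i<f x. D \<langle>x, i\<rangle> (entry (list_encode (map w [0..<f x])) i)"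
        by (simp add: entry_list_encode)
      then show "\<exists>l. \<forall>i<f x. D \<langle>x, i\<rangle> (entry l i)" ..
    qed (auto simp: P)
  qed
qed

section \<open>Inductive definitions with coded derivations as certificates\<close>

section \<open>Inductively defined sets\<close>

text \<open>Two premises are enough throughout: a rule with one premise repeats it, and a rule with
  a variable number of premises is split by an auxiliary judgement that absorbs them one at a
  time.\<close>

inductive clos :: "(nat \<Rightarrow> bool) \<Rightarrow> (nat \<Rightarrow> nat \<Rightarrow> nat \<Rightarrow> bool) \<Rightarrow> nat \<Rightarrow> bool" for B R where
  base: "B c \<Longrightarrow> clos B R c"
| step: "R a b c \<Longrightarrow> clos B R a \<Longrightarrow> clos B R b \<Longrightarrow> clos B R c"

text \<open>A derivation, listed with its conclusion first.\<close>

fun derivation :: "(nat \<Rightarrow> bool) \<Rightarrow> (nat \<Rightarrow> nat \<Rightarrow> nat \<Rightarrow> bool) \<Rightarrow> nat list \<Rightarrow> bool" where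
  "derivation B R [] \<longleftrightarrow> True"
| "derivation B R (c # cs) \<longleftrightarrow>
     (B c \<or> (\<exists>a\<in>set cs. \<exists>b\<in>set cs. R a b c)) \<and> derivation B R cs"

lemma derivation_append:
  "derivation B R xs \<Longrightarrow> derivation B R ys \<Longrightarrow> derivation B R (xs @ ys)"
  by (induction xs) auto

lemma clos_derivation:
  assumes "clos B R c"
  shows "\<exists>cs. derivation B R (c # cs)"
  using assms
proof induction
  case (base c)
  then show ?case by (intro exI[of _ "[]"]) simp
next
  case (step a b c)
  then obtain as bs where "derivation B R (a # as)" "derivation B R (b # bs)" by blast
  then have "derivation B R (c # (a # as) @ (b # bs))"
    using derivation_append[of B R "a # as" "b # bs"] step.hyps(1) by auto
  then show ?case ..
qed

text \<open>With the conclusion listed first, premises sit at strictly larger positions. In terms of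
  positions the condition has only bounded quantifiers and can be read off a coded list.\<close>

lemma derivation_nth:
  assumes "derivation B R cs" "i < length cs"
  shows "B (cs ! i) \<or> (\<exists>j k. i < j \<and> j < length cs \<and> i < k \<and> k < length cs \<and>
    R (cs ! j) (cs ! k) (cs ! i))"
  using assms
proof (induction cs arbitrary: i)
  case (Cons c cs)
  show ?case
  proof (cases i)
    case 0
    consider "B c" | j k where "j < length cs" "k < length cs" "R (cs ! j) (cs ! k) c"
      using Cons.prems(1) by (auto simp: in_set_conv_nth)
    then show ?thesis
    proof cases
      case (2 j k)
      with 0 show ?thesis by (intro disjI2 exI[of _ "Suc j"] exI[of _ "Suc k"]) simp
    qed (simp add: 0)
  next
    case (Suc m)
    then consider "B (cs ! m)" | j k where "m < j" "j < length cs" "m < k" "k < length cs"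
      "R (cs ! j) (cs ! k) (cs ! m)"
      using Cons.IH[of m] Cons.prems by auto
    then show ?thesis
    proof cases
      case (2 j k)
      with Suc show ?thesis by (intro disjI2 exI[of _ "Suc j"] exI[of _ "Suc k"]) simp
    qed (simp add: Suc)
  qed
qed simp

lemma semidec_clos:
  assumes "semidec B" and "semidec (\<lambda>z. R (p1 z) (p1 (p2 z)) (p2 (p2 z)))"
  shows "semidec (clos B R)"
proof -
  \<comment> \<open>Since \<open>entry\<close> is total, any two numbers \<open>n\<close> and
    \<open>l\<close> can be tested as a derivation with \<open>n\<close> lines.\<close>
  let ?ok = "\<lambda>n l i. B (entry l i) \<or>
    (\<exists>j k. i < j \<and> j < n \<and> i < k \<and> k < n \<and> R (entry l j) (entry l k) (entry l i))"
  have R: "semidec (\<lambda>x. R (f x) (g x) (h x))"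
    if "computable f" "computable g" "computable h" for f g h
    using semidec_comp[OF assms(2) computable_pair[OF that(1) computable_pair[OF that(2,3)]]]
    by simp
  have semidec: "semidec (\<lambda>c. \<exists>n l. entry l 0 = c \<and> 0 < n \<and> (\<forall>i<n. ?ok n l i))"
    by (intro semidec_intros computable_intros semidec_comp[OF assms(1)] R)
  have "clos B R c \<longleftrightarrow> (\<exists>n l. entry l 0 = c \<and> 0 < n \<and> (\<forall>i<n. ?ok n l i))" for c
  proof
    assume "clos B R c"
    then obtain cs where cs: "derivation B R (c # cs)" using clos_derivation by blast
    let ?l = "c # cs"
    show "\<exists>n l. entry l 0 = c \<and> 0 < n \<and> (\<forall>i<n. ?ok n l i)"
    proof (intro exI conjI allI impI)
      show "?ok (length ?l) (list_encode ?l) i" if i: "i < length ?l" for i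
      proof -
        from i have *: "entry (list_encode ?l) i = ?l ! i" by (rule entry_list_encode)
        consider "B (?l ! i)" | j k where "i < j" "j < length ?l" "i < k" "k < length ?l"
          "R (?l ! j) (?l ! k) (?l ! i)"
          using derivation_nth[OF cs i] by blast
        then show ?thesis
        proof cases
          case (2 j k)
          then have "R (entry (list_encode ?l) j) (entry (list_encode ?l) k) (entry (list_encode ?l) i)"
            by (simp only: entry_list_encode *)
          with 2 show ?thesis by blast
        qed (simp only: * simp_thms)
      qed
      show "entry (list_encode ?l) 0 = c"
        using entry_list_encode[of 0 ?l] by (simp del: list_encode.simps)
    qed simp
  next
    assume "\<exists>n l. entry l 0 = c \<and> 0 < n \<and> (\<forall>i<n. ?ok n l i)"
    then obtain n l where nl: "entry l 0 = c" "0 < n" "\<forall>i<n. ?ok n l i" by blast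
    have "i < n \<Longrightarrow> clos B R (entry l i)" for i
    \<comment> \<open>Premises stand to the right of their conclusion, so the induction runs from
      the last line to the first.\<close>
    proof (induction "n - i" arbitrary: i rule: less_induct)
      case less
      then have IH: "clos B R (entry l j)" if "i < j" "j < n" for j
        using that by (simp add: diff_less_mono2)
      from less.prems nl(3) have "?ok n l i" by blast
      then show ?case using IH by (auto intro: clos.intros)
    qed
    with nl show "clos B R c" by blast
  qed
  then have "clos B R = (\<lambda>c. \<exists>n l. entry l 0 = c \<and> 0 < n \<and> (\<forall>i<n. ?ok n l i))" by (rule ext)
  with semidec show ?thesis by (simp only:)
qed

section \<open>A universal program, obtained from a calculus of computation judgements\<close>

section \<open>The universal semidecidable set\<close>

text \<open>Atomic programs take the numbers 0 to 3; a composite one has a number of at least 4, and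
  its residue modulo 4 reveals the constructor.\<close>

lemma prog_num_inj: "prog_num p = prog_num q \<Longrightarrow> p = q"
proof (induction p arbitrary: q)
  case (Tup a b)
  from Tup.prems have "\<exists>c d. q = Tup c d" by (cases q; simp; presburger)
  then show ?case using Tup by auto
next
  case (Comp a b)
  from Comp.prems have "\<exists>c d. q = Comp c d" by (cases q; simp; presburger)
  then show ?case using Comp by auto
next
  case (Rec a b)
  from Rec.prems have "\<exists>c d. q = Rec c d" by (cases q; simp; presburger)
  then show ?case using Rec by auto
next
  case (Mu a)
  from Mu.prems have "\<exists>c. q = Mu c" by (cases q; simp; presburger)
  then show ?case using Mu by auto
qed (case_tac [!] q; simp)+

definition run :: "nat \<Rightarrow> nat \<Rightarrow> nat \<Rightarrow> nat" where "run e x y = \<langle>0, \<langle>e, \<langle>x, y\<rangle>\<rangle>\<rangle>"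

text \<open>The auxiliary judgement \<open>search e x n\<close> (no root of the function with index \<open>e\<close> and
  parameter \<open>x\<close> below \<open>n\<close>) splits the infinitary-looking rule for \<^const>\<open>Mu\<close> into rules with
  at most two premises.\<close>

definition search :: "nat \<Rightarrow> nat \<Rightarrow> nat \<Rightarrow> nat" where "search e x n = \<langle>1, \<langle>e, \<langle>x, n\<rangle>\<rangle>\<rangle>"

inductive run_base :: "nat \<Rightarrow> bool" where
  "run_base (run 0 x 0)"
| "run_base (run 1 x (Suc x))"
| "run_base (run 2 x (p1 x))"
| "run_base (run 3 x (p2 x))"
| "run_base (search e x 0)"

text \<open>The constants are those of \<open>prog_num\<close>, so the rules act on indices
  arithmetically, without decoding a program. The start of a recursion has one premise, repeated to
  fit the format of \<open>clos\<close>.\<close>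

inductive run_step :: "nat \<Rightarrow> nat \<Rightarrow> nat \<Rightarrow> bool" where
  "run_step (run d x y) (run e x z) (run (4 * \<langle>d, e\<rangle> + 4) x \<langle>y, z\<rangle>)"
| "run_step (run e x y) (run d y z) (run (4 * \<langle>d, e\<rangle> + 5) x z)"
| "run_step (run d x y) (run d x y) (run (4 * \<langle>d, e\<rangle> + 6) \<langle>x, 0\<rangle> y)"
| "run_step (run (4 * \<langle>d, e\<rangle> + 6) \<langle>x, n\<rangle> y) (run e \<langle>x, \<langle>n, y\<rangle>\<rangle> z)
     (run (4 * \<langle>d, e\<rangle> + 6) \<langle>x, Suc n\<rangle> z)"
| "run_step (search e x n) (run e \<langle>x, n\<rangle> (Suc y)) (search e x (Suc n))"
| "run_step (search e x n) (run e \<langle>x, n\<rangle> 0) (run (4 * e + 7) x n)"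

lemma run_eq [simp]:
  "run e x y = run e' x' y' \<longleftrightarrow> e = e' \<and> x = x' \<and> y = y'"
  "search e x y = search e' x' y' \<longleftrightarrow> e = e' \<and> x = x' \<and> y = y'"
  "run e x y \<noteq> search e' x' y'" "search e x y \<noteq> run e' x' y'"
  by (simp_all add: run_def search_def)

text \<open>The rules for \<open>run\<close> range over all numbers as indices, so soundness has to
  read every number as a program. Decoding descends because the components of a pair never exceed
  its code.\<close>

lemma prog_num_surj: "\<exists>p. prog_num p = n"
proof (induction n rule: less_induct)
  case (less n)
  show ?case
  proof (cases "n < 4")
    case True
    then have "n = prog_num Zero \<or> n = prog_num Succ \<or> n = prog_num Left \<or> n = prog_num Right"
      by simp presburger
    then show ?thesis by metis
  next
    case False
    define m where "m = (n - 4) div 4"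
    have "m < n"
      unfolding m_def using False by presburger
    then have m: "m < n" "p1 m < n" "p2 m < n"
      using le_prod_encode_1[of "p1 m" "p2 m"] le_prod_encode_2[of "p2 m" "p1 m"]
      by simp_all
    obtain p q r where "prog_num p = p1 m" "prog_num q = p2 m" "prog_num r = m"
      using less m by blast
    moreover have "n = 4 * m + 4 \<or> n = 4 * m + 5 \<or> n = 4 * m + 6 \<or> n = 4 * m + 7"
      unfolding m_def using False by presburger
    ultimately have "n = prog_num (Tup p q) \<or> n = prog_num (Comp p q) \<or>
        n = prog_num (Rec p q) \<or> n = prog_num (Mu r)"
      by simp
    then show ?thesis by metis
  qed
qed

lemma prog_num_eq_iff [simp]: "prog_num p = prog_num q \<longleftrightarrow> p = q"
  using prog_num_inj by blast

text \<open>Both judgements must be treated together: \<open>search\<close> has \<open>run\<close>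
  among its premises, and \<open>run\<close> for a \<open>Mu\<close> program has
  \<open>search\<close>.\<close>

lemma clos_run_sound:
  assumes "clos run_base run_step c"
  shows "(\<forall>p x y. c = run (prog_num p) x y \<longrightarrow> computes p x y) \<and>
    (\<forall>p x n. c = search (prog_num p) x n \<longrightarrow> (\<forall>m<n. \<exists>y. computes p \<langle>x, m\<rangle> (Suc y)))"
  using assms
proof induction
  case (base c)
  then show ?case
  proof cases
    case (1 x)
    then show ?thesis using prog_num_inj[of _ Zero] by (auto intro: computes.intros)
  next
    case (2 x)
    then show ?thesis using prog_num_inj[of _ Succ] by (auto intro: computes.intros)
  next
    case (3 x)
    then show ?thesis using prog_num_inj[of _ Left] by (auto simp: p1_def intro: computes.intros)
  next
    case (4 x)
    then show ?thesis using prog_num_inj[of _ Right] by (auto simp: p2_def intro: computes.intros)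
  qed auto
next
  case (step a b c)
  have ex: "\<exists>p. n = prog_num p" for n using prog_num_surj by metis
  from step.hyps(1) show ?case
  proof cases
    case (1 d x y e z)
    from ex obtain p q where "d = prog_num p" "e = prog_num q" by metis
    with 1 have "a = run (prog_num p) x y" "b = run (prog_num q) x z"
      "c = run (prog_num (Tup p q)) x \<langle>y, z\<rangle>" by simp_all
    then show ?thesis using step.IH by (simp add: computes.intros(5) del: prog_num.simps)
  next
    case (2 e x y d z)
    from ex obtain p q where "d = prog_num p" "e = prog_num q" by metis
    with 2 have "a = run (prog_num q) x y" "b = run (prog_num p) y z"
      "c = run (prog_num (Comp p q)) x z" by simp_all
    then show ?thesis
      using step.IH computes.intros(6)[of q x y p z] by (simp del: prog_num.simps)
  next
    case (3 d x y e)
    from ex obtain p q where "d = prog_num p" "e = prog_num q" by metis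
    with 3 have "a = run (prog_num p) x y" "c = run (prog_num (Rec p q)) \<langle>x, 0\<rangle> y" by simp_all
    then show ?thesis using step.IH by (simp add: computes.intros(7) del: prog_num.simps)
  next
    case (4 d e x n y z)
    from ex obtain p q where "d = prog_num p" "e = prog_num q" by metis
    with 4 have "a = run (prog_num (Rec p q)) \<langle>x, n\<rangle> y" "b = run (prog_num q) \<langle>x, \<langle>n, y\<rangle>\<rangle> z"
      "c = run (prog_num (Rec p q)) \<langle>x, Suc n\<rangle> z" by simp_all
    then show ?thesis
      using step.IH computes.intros(8)[of p q x n y z] by (simp del: prog_num.simps)
  next
    case (5 e x n y)
    then show ?thesis using step.IH by (auto simp: less_Suc_eq)
  next
    case (6 e x n)
    from ex obtain p where "e = prog_num p" by metis
    with 6 have "a = search (prog_num p) x n" "b = run (prog_num p) \<langle>x, n\<rangle> 0"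
      "c = run (prog_num (Mu p)) x n" by simp_all
    then show ?thesis using step.IH computes.intros(9)[of n p x] by (simp del: prog_num.simps)
  qed
qed

lemma clos_run_complete: "computes p x y \<Longrightarrow> clos run_base run_step (run (prog_num p) x y)"
proof (induction rule: computes.induct)
  case (5 p x y q z)
  then show ?case unfolding prog_num.simps by (intro clos.step[where R = run_step, OF run_step.intros(1)])
next
  case (6 q x y p z)
  then show ?case unfolding prog_num.simps by (intro clos.step[where R = run_step, OF run_step.intros(2)])
next
  case (7 p x y q)
  then show ?case unfolding prog_num.simps by (intro clos.step[where R = run_step, OF run_step.intros(3)])
next
  case (8 p q x n y z)
  then show ?case unfolding prog_num.simps by (intro clos.step[where R = run_step, OF run_step.intros(4)])
next
  case (9 n p x)
  \<comment> \<open>The premises of the rule for \<open>Mu\<close> below \<open>n\<close> are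
    absorbed one at a time into \<open>search\<close>.\<close>
  have "m \<le> n \<Longrightarrow> clos run_base run_step (search (prog_num p) x m)" for m
  proof (induction m)
    case 0
    show ?case by (intro clos.base run_base.intros)
  next
    case (Suc m)
    from Suc.prems have "m < n" by simp
    with 9(1) obtain y where "clos run_base run_step (run (prog_num p) \<langle>x, m\<rangle> (Suc y))"
      by blast
    moreover have "clos run_base run_step (search (prog_num p) x m)" using Suc by simp
    ultimately show ?case by (intro clos.step[where R = run_step, OF run_step.intros(5)])
  qed
  then have "clos run_base run_step (search (prog_num p) x n)" by simp
  with 9(2) show ?case
    unfolding prog_num.simps by (intro clos.step[where R = run_step, OF run_step.intros(6)])
qed (use run_base.intros in \<open>auto intro!: clos.base simp: p1_def p2_def\<close>)

lemma computable_run [computable_intros]: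
  "computable f \<Longrightarrow> computable g \<Longrightarrow> computable h \<Longrightarrow> computable (\<lambda>x. run (f x) (g x) (h x))"
  unfolding run_def by (intro computable_intros)

lemma computable_search [computable_intros]:
  "computable f \<Longrightarrow> computable g \<Longrightarrow> computable h \<Longrightarrow> computable (\<lambda>x. search (f x) (g x) (h x))"
  unfolding search_def by (intro computable_intros)

text \<open>Element and index may both depend on the input; this is the universal c.e. set in the
  form that gives uniformity in the code of an algebra.\<close>

lemma semidec_W [semidec_intros]:
  assumes "computable f" "computable g"
  shows "semidec (\<lambda>x. f x \<in> W (g x))"
proof -
  have "semidec run_base"
    by (rule semidec_cong[OF run_base.simps]) (intro semidec_intros computable_intros)
  moreover have "semidec (\<lambda>z. run_step (p1 z) (p1 (p2 z)) (p2 (p2 z)))"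
    by (rule semidec_cong[OF run_step.simps]) (intro semidec_intros computable_intros)
  ultimately have clos: "semidec (clos run_base run_step)"
    by (rule semidec_clos)
  have "semidec (\<lambda>x. \<exists>y. clos run_base run_step (run (g x) (f x) y))"
    by (intro semidec_ex semidec_comp[OF clos] computable_intros
        computable_comp[OF assms(1)] computable_comp[OF assms(2)])
  moreover have "f x \<in> W (g x) \<longleftrightarrow> (\<exists>y. clos run_base run_step (run (g x) (f x) y))" for x
  proof -
    obtain p where p: "g x = prog_num p" using prog_num_surj by metis
    have "f x \<in> W (g x) \<longleftrightarrow> (\<exists>y. computes p (f x) y)" by (simp add: W_def p)
    also have "\<dots> \<longleftrightarrow> (\<exists>y. clos run_base run_step (run (g x) (f x) y))"
      using clos_run_complete clos_run_sound unfolding p by metis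
    finally show ?thesis .
  qed
  ultimately show ?thesis by simp
qed

section \<open>The s-m-n theorem for semidecidable relations\<close>

section \<open>Parametrisation\<close>

inductive_cases computes_elims:
  "computes Zero x y" "computes Succ x y" "computes Left x y" "computes Right x y"
  "computes (Tup p q) x y" "computes (Comp p q) x y" "computes (Rec p q) x y" "computes (Mu p) x y"

text \<open>Determinism supplies the negative information that an inductive definition lacks. For
  \<open>Mu\<close>, two different results would force the value at the smaller one to be both zero
  and a successor.\<close>

lemma computes_functional: "computes p x y \<Longrightarrow> computes p x z \<Longrightarrow> y = z"
proof (induction arbitrary: z rule: computes.induct)
  case (5 p x y q z w)
  from 5(5) show ?case by (rule computes_elims) (auto dest: "5.IH")
next
  case (6 q x y p z w)
  from 6(5) show ?case by (rule computes_elims) (auto dest: "6.IH")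
next
  case (7 p x y q z)
  from 7(3) show ?case by (rule computes_elims) (auto dest: "7.IH")
next
  case (8 p q x n y z w)
  from 8(5) show ?case by (rule computes_elims) (auto dest: "8.IH")
next
  case (9 n p x)
  from 9(4) have z: "\<forall>m<z. \<exists>y. computes p \<langle>x, m\<rangle> (Suc y)" "computes p \<langle>x, z\<rangle> 0"
    by (auto elim: computes_elims)
  show ?case
  proof (cases n z rule: linorder_cases)
    case less
    with z(1) "9.IH" show ?thesis by blast
  next
    case greater
    with z(2) 9(1) show ?thesis by blast
  qed
qed (auto elim: computes_elims)

lemma semidec_W_index:
  assumes "semidec (\<lambda>z. Q (p1 z) (p2 z))"
  obtains h where "computable h" "\<And>x. W (h x) = {n. Q x n}"
proof -
  obtain D where D: "dec (\<lambda>z. D (p1 z) (p2 z))" "\<And>z. Q (p1 z) (p2 z) \<longleftrightarrow> (\<exists>w. D z w)"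
    using assms by (auto elim: semidecE)
  then obtain p where p: "\<And>z. computes p z (if D (p1 z) (p2 z) then 0 else 1)"
    unfolding dec_def computable_def by blast
  have p_eq: "computes p \<langle>z, w\<rangle> u \<longleftrightarrow> u = (if D z w then 0 else 1)" for z w u
    using p[of "\<langle>z, w\<rangle>"] computes_functional by auto
  have Mu: "(\<exists>y. computes (Mu p) z y) \<longleftrightarrow> Q (p1 z) (p2 z)" for z
  proof
    assume "\<exists>y. computes (Mu p) z y"
    then obtain w where "computes p \<langle>z, w\<rangle> 0"
      by (auto elim: computes_elims)
    then have "D z w" by (simp add: p_eq split: if_splits)
    then show "Q (p1 z) (p2 z)" unfolding D(2) ..
  next
    assume "Q (p1 z) (p2 z)"
    then have ex: "\<exists>w. D z w" unfolding D(2) .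
    \<comment> \<open>\<open>Mu\<close> stops at the least zero and requires all earlier values to
      be defined; they are, since \<open>p\<close> is total.\<close>
    define w where "w = (LEAST w. D z w)"
    from ex have "D z w" unfolding w_def by (rule LeastI_ex)
    moreover have "\<not> D z m" if "m < w" for m using that unfolding w_def by (rule not_less_Least)
    ultimately have "computes (Mu p) z w"
      by (intro computes.intros(9)) (use p in \<open>simp_all add: p_eq\<close>)
    then show "\<exists>y. computes (Mu p) z y" ..
  qed
  define K where "K = rec_nat Zero (\<lambda>_ q. Comp Succ q)"
  have K: "computes (K x) n x" for x n
    by (induction x) (auto simp: K_def intro: computes.intros)
  define h where "h x = prog_num (Comp (Mu p) (Tup (K x) (Tup Left Right)))" for x
  \<comment> \<open>\<open>K x\<close> has constant value \<open>x\<close> and consists of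
    \<open>x\<close> layers \<open>Comp Succ\<close>; 1 is the number of \<open>Succ\<close> and 5
    the offset of \<open>Comp\<close>. The index of the specialised program is thus primitive
    recursive in \<open>x\<close>.\<close>
  have "prog_num (K x) = rec_nat 0 (\<lambda>_ y. 4 * \<langle>1, y\<rangle> + 5) x" for x
    by (induction x) (simp_all add: K_def)
  then have h_eq: "h = (\<lambda>x. 4 * \<langle>prog_num (Mu p), 4 * \<langle>rec_nat 0 (\<lambda>_ y. 4 * \<langle>1, y\<rangle> + 5) x,
      prog_num (Tup Left Right)\<rangle> + 4\<rangle> + 5)"
    by (auto simp: h_def)
  have "computable h"
    unfolding h_eq by (intro computable_intros computable_rec)
  moreover have "W (h x) = {n. Q x n}" for x
  proof -
    have arg: "computes (Tup (K x) (Tup Left Right)) n \<langle>x, n\<rangle>" for n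
      using computes.intros(5)[OF K computes.intros(5)[OF computes.intros(3) computes.intros(4)]]
      by (metis prod.collapse prod_decode_inverse)
    have "n \<in> W (h x) \<longleftrightarrow> (\<exists>y. computes (Comp (Mu p) (Tup (K x) (Tup Left Right))) n y)" for n
      unfolding W_def h_def by (simp del: prog_num.simps)
    also have "\<dots> n \<longleftrightarrow> (\<exists>y. computes (Mu p) \<langle>x, n\<rangle> y)" for n
    proof
      assume "\<exists>y. computes (Comp (Mu p) (Tup (K x) (Tup Left Right))) n y"
      then obtain u y where "computes (Tup (K x) (Tup Left Right)) n u" "computes (Mu p) u y"
        by (auto elim: computes_elims)
      with computes_functional[OF arg] show "\<exists>y. computes (Mu p) \<langle>x, n\<rangle> y" by blast
    qed (use arg in \<open>blast intro: computes.intros(6)\<close>)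
    finally show ?thesis using Mu by auto
  qed
  ultimately show thesis by (rule that)
qed

section \<open>The correspondence theorem for congruences and the transfer of ACC\<close>

section \<open>Quotient algebras and congruences\<close>

text \<open>A congruence relates carrier elements only, so related lists are lists over the carrier,
  and of membership in \<open>args\<close> just the length remains to be checked.\<close>

lemma congruenceD:
  assumes "congruence ar A \<theta>"
  shows congruence_equiv: "equiv (carrier A) \<theta>"
    and congruence_interp: "\<And>f xs ys. f < length ar \<Longrightarrow> length xs = ar ! f \<Longrightarrow>
      list_all2 (\<lambda>x y. (x, y) \<in> \<theta>) xs ys \<Longrightarrow> (interp A f xs, interp A f ys) \<in> \<theta>"
proof -
  show equiv: "equiv (carrier A) \<theta>" using assms unfolding congruence_def by blast
  fix f xs ys
  assume f: "f < length ar" "length xs = ar ! f" and xs: "list_all2 (\<lambda>x y. (x, y) \<in> \<theta>) xs ys"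
  from equiv have sub: "\<theta> \<subseteq> carrier A \<times> carrier A" by (rule equiv_type)
  from xs have len: "length ys = length xs" and nth: "\<And>i. i < length xs \<Longrightarrow> (xs ! i, ys ! i) \<in> \<theta>"
    by (simp_all add: list_all2_conv_all_nth)
  have "set xs \<subseteq> carrier A" "set ys \<subseteq> carrier A"
    using nth sub len by (fastforce simp: set_conv_nth)+
  then have "xs \<in> args ar A f" "ys \<in> args ar A f"
    using f len by (simp_all add: args_def)
  with assms f xs show "(interp A f xs, interp A f ys) \<in> \<theta>"
    unfolding congruence_def by blast
qed

lemma congruence_refl: "congruence ar A \<theta> \<Longrightarrow> x \<in> carrier A \<Longrightarrow> (x, x) \<in> \<theta>"
  and congruence_sym: "congruence ar A \<theta> \<Longrightarrow> (x, y) \<in> \<theta> \<Longrightarrow> (y, x) \<in> \<theta>"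
  and congruence_trans: "congruence ar A \<theta> \<Longrightarrow> (x, y) \<in> \<theta> \<Longrightarrow> (y, z) \<in> \<theta> \<Longrightarrow> (x, z) \<in> \<theta>"
  and congruence_carrier: "congruence ar A \<theta> \<Longrightarrow> (x, y) \<in> \<theta> \<Longrightarrow> x \<in> carrier A \<and> y \<in> carrier A"
  using congruence_equiv[of ar A \<theta>]
  by (auto simp: equiv_def dest: refl_onD symD transD)

lemma class_eq_iff:
  assumes "congruence ar A \<theta>" "x \<in> carrier A"
  shows "\<theta> `` {x} = \<theta> `` {y} \<longleftrightarrow> (x, y) \<in> \<theta>"
  by (metis assms congruence_equiv congruence_refl congruence_sym equiv_class_eq Image_singleton_iff)

text \<open>\<open>quotient_alg\<close> evaluates an operation at all choices of representatives;
  compatibility makes these values congruent, so their classes coincide.\<close>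

lemma quotient_interp:
  assumes "congruence ar A \<theta>" "f < length ar" "xs \<in> args ar A f"
  shows "interp (quotient_alg A \<theta>) f (map (\<lambda>x. \<theta> `` {x}) xs) = \<theta> `` {interp A f xs}"
proof -
  have len: "length xs = ar ! f" and xs: "set xs \<subseteq> carrier A" using assms(3) by (auto simp: args_def)
  have "list_all2 (\<in>) ys (map (\<lambda>x. \<theta> `` {x}) xs) \<longleftrightarrow> list_all2 (\<lambda>x y. (x, y) \<in> \<theta>) xs ys" for ys
    by (auto simp: list_all2_conv_all_nth)
  then have "interp (quotient_alg A \<theta>) f (map (\<lambda>x. \<theta> `` {x}) xs) =
      \<theta> `` {interp A f ys | ys. list_all2 (\<lambda>x y. (x, y) \<in> \<theta>) xs ys}"
    by (simp add: quotient_alg_def)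
  also have "\<dots> = \<theta> `` {interp A f xs}"
  proof -
    have "list_all2 (\<lambda>x y. (x, y) \<in> \<theta>) xs xs"
      using xs congruence_refl[OF assms(1)] by (auto intro!: list.rel_refl_strong)
    moreover have "(interp A f xs, interp A f ys) \<in> \<theta>" if "list_all2 (\<lambda>x y. (x, y) \<in> \<theta>) xs ys" for ys
      using congruence_interp[OF assms(1,2) len that] .
    ultimately show ?thesis using congruence_trans[OF assms(1)] by blast
  qed
  finally show ?thesis .
qed

lemma quotient_list:
  assumes "set Cs \<subseteq> B // \<theta>"
  obtains xs where "Cs = map (\<lambda>x. \<theta> `` {x}) xs" "set xs \<subseteq> B"
proof -
  have "\<exists>xs. Cs = map (\<lambda>x. \<theta> `` {x}) xs \<and> set xs \<subseteq> B"
    using assms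
  proof (induction Cs)
    case (Cons C Cs)
    then obtain xs x where "Cs = map (\<lambda>x. \<theta> `` {x}) xs" "set xs \<subseteq> B" "C = \<theta> `` {x}" "x \<in> B"
      by (auto elim: quotientE)
    then show ?case by (intro exI[of _ "x # xs"]) simp
  qed simp
  then show thesis using that by blast
qed

text \<open>The image of \<open>\<theta>\<close> in the quotient by \<open>\<phi>\<close>: one half
  of the correspondence between congruences above \<open>\<phi>\<close> and congruences of the
  quotient.\<close>

definition quotient_rel :: "('a \<times> 'a) set \<Rightarrow> ('a \<times> 'a) set \<Rightarrow> ('a set \<times> 'a set) set" where
  "quotient_rel \<phi> \<theta> = {(\<phi> `` {x}, \<phi> `` {y}) | x y. (x, y) \<in> \<theta>}"

lemma quotient_rel_iff:
  assumes \<phi>: "congruence ar A \<phi>" and \<theta>: "congruence ar A \<theta>" and sub: "\<phi> \<subseteq> \<theta>"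
    and xy: "x \<in> carrier A" "y \<in> carrier A"
  shows "(\<phi> `` {x}, \<phi> `` {y}) \<in> quotient_rel \<phi> \<theta> \<longleftrightarrow> (x, y) \<in> \<theta>"
proof
  assume "(\<phi> `` {x}, \<phi> `` {y}) \<in> quotient_rel \<phi> \<theta>"
  then obtain x' y' where *: "\<phi> `` {x} = \<phi> `` {x'}" "\<phi> `` {y} = \<phi> `` {y'}" "(x', y') \<in> \<theta>"
    unfolding quotient_rel_def by blast
  with xy have "(x, x') \<in> \<theta>" "(y, y') \<in> \<theta>"
    using class_eq_iff[OF \<phi>] sub by blast+
  with * show "(x, y) \<in> \<theta>" using congruence_sym[OF \<theta>] congruence_trans[OF \<theta>] by meson
qed (auto simp: quotient_rel_def)

lemma congruence_quotient:
  assumes \<phi>: "congruence ar A \<phi>" and \<theta>: "congruence ar A \<theta>" and sub: "\<phi> \<subseteq> \<theta>"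
  shows "congruence ar (quotient_alg A \<phi>) (quotient_rel \<phi> \<theta>)"
    (is "congruence ar ?Q ?\<theta>")
proof -
  note mem = quotient_rel_iff[OF assms]
  have "equiv (carrier ?Q) ?\<theta>"
  proof (rule equivI)
    show "?\<theta> \<subseteq> carrier ?Q \<times> carrier ?Q"
      using congruence_carrier[OF \<theta>] by (auto simp: quotient_alg_def quotient_rel_def intro: quotientI)
    show "refl_on (carrier ?Q) ?\<theta>"
      using congruence_refl[OF \<theta>] mem
      by (auto simp: quotient_alg_def elim!: quotientE intro!: refl_onI)
    show "sym ?\<theta>" using congruence_sym[OF \<theta>] by (auto simp: quotient_rel_def intro!: symI)
    show "trans ?\<theta>"
    proof (rule transI)
      fix X Y Z assume "(X, Y) \<in> ?\<theta>" "(Y, Z) \<in> ?\<theta>"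
      then obtain x y z where xyz: "X = \<phi> `` {x}" "Y = \<phi> `` {y}" "(x, y) \<in> \<theta>"
        "(\<phi> `` {y}, \<phi> `` {z}) \<in> ?\<theta>" "Z = \<phi> `` {z}" "z \<in> carrier A"
        using congruence_carrier[OF \<theta>] unfolding quotient_rel_def by blast
      then have "(y, z) \<in> \<theta>" using mem congruence_carrier[OF \<theta>] by blast
      with xyz show "(X, Z) \<in> ?\<theta>"
        using congruence_trans[OF \<theta>] unfolding quotient_rel_def by blast
    qed
  qed
  moreover have "(interp ?Q f Cs, interp ?Q f Ds) \<in> ?\<theta>"
    if "f < length ar" "Cs \<in> args ar ?Q f" "Ds \<in> args ar ?Q f"
      "list_all2 (\<lambda>x y. (x, y) \<in> ?\<theta>) Cs Ds" for f Cs Ds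
  proof -
    from that obtain xs ys where xs: "Cs = map (\<lambda>x. \<phi> `` {x}) xs" "set xs \<subseteq> carrier A"
      and ys: "Ds = map (\<lambda>x. \<phi> `` {x}) ys" "set ys \<subseteq> carrier A"
      unfolding args_def quotient_alg_def by (auto elim!: quotient_list)
    have args: "xs \<in> args ar A f" "ys \<in> args ar A f"
      using that(2,3) xs ys by (auto simp: args_def)
    have "list_all2 (\<lambda>x y. (\<phi> `` {x}, \<phi> `` {y}) \<in> ?\<theta>) xs ys"
      using that(4) unfolding xs(1) ys(1) by (simp only: list.rel_map)
    then have "list_all2 (\<lambda>x y. (x, y) \<in> \<theta>) xs ys"
    proof (rule list.rel_mono_strong)
      fix x y assume "x \<in> set xs" "y \<in> set ys" "(\<phi> `` {x}, \<phi> `` {y}) \<in> ?\<theta>"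
      with mem[of x y] xs(2) ys(2) show "(x, y) \<in> \<theta>" by blast
    qed
    then have "(interp A f xs, interp A f ys) \<in> \<theta>"
      using congruence_interp[OF \<theta> that(1)] args(1) by (simp add: args_def)
    then show ?thesis
      unfolding xs(1) ys(1) quotient_interp[OF \<phi> that(1) args(1)] quotient_interp[OF \<phi> that(1) args(2)]
      unfolding quotient_rel_def by blast
  qed
  ultimately show ?thesis unfolding congruence_def by blast
qed

text \<open>Carries the chain condition from a quotient back to the algebra itself, where
  substitutions and pullbacks live.\<close>

lemma ACC_quotient:
  assumes ACC: "ACC_alg ar (quotient_alg A \<phi>)" and \<phi>: "congruence ar A \<phi>"
    and \<theta>: "\<And>n. congruence ar A (\<theta> n)" "\<And>n. \<phi> \<subseteq> \<theta> n" "\<And>n. \<theta> n \<subseteq> \<theta> (Suc n)"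
  obtains N where "\<And>n. n \<ge> N \<Longrightarrow> \<theta> n = \<theta> N"
proof -
  let ?q = "\<lambda>n. quotient_rel \<phi> (\<theta> n)"
  have "\<forall>n. congruence ar (quotient_alg A \<phi>) (?q n)"
    using congruence_quotient[OF \<phi> \<theta>(1,2)] by blast
  moreover have "\<forall>n. ?q n \<subseteq> ?q (Suc n)"
    using \<theta>(3) unfolding quotient_rel_def by blast
  ultimately obtain N where N: "\<forall>n\<ge>N. ?q n = ?q N"
    using ACC[unfolded ACC_alg_def, rule_format, of ?q] by blast
  \<comment> \<open>The other half of the correspondence: \<open>lift\<close> recovers a congruence
    above \<open>\<phi>\<close> from its image, so equal images come from equal congruences.\<close>
  define lift where "lift Q = {(x, y) \<in> carrier A \<times> carrier A. (\<phi> `` {x}, \<phi> `` {y}) \<in> Q}" for Q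
  have "\<theta> n = lift (?q n)" for n
    unfolding lift_def using quotient_rel_iff[OF \<phi> \<theta>(1,2)] congruence_carrier[OF \<theta>(1)] by auto
  with N have "\<theta> n = \<theta> N" if "n \<ge> N" for n using that by metis
  then show thesis by (rule that)
qed

text \<open>The type \<open>alg\<close> does not force operations to stay in the carrier, and the
  inverse of \<open>h\<close> can be cancelled only at carrier elements; hence the closure
  assumption.\<close>

lemma isomorphic_sym:
  assumes "isomorphic ar A B"
    and closed: "\<And>f xs. f < length ar \<Longrightarrow> xs \<in> args ar A f \<Longrightarrow> interp A f xs \<in> carrier A"
  shows "isomorphic ar B A"
proof -
  obtain h where h: "bij_betw h (carrier A) (carrier B)"
    and hom: "\<And>f xs. f < length ar \<Longrightarrow> xs \<in> args ar A f \<Longrightarrow> h (interp A f xs) = interp B f (map h xs)"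
    using assms(1) unfolding isomorphic_def by blast
  let ?g = "inv_into (carrier A) h"
  have "?g (interp B f ys) = interp A f (map ?g ys)" if "f < length ar" "ys \<in> args ar B f" for f ys
  proof -
    have g: "\<And>y. y \<in> set ys \<Longrightarrow> ?g y \<in> carrier A \<and> h (?g y) = y"
      using that(2) h by (auto simp: args_def bij_betw_def f_inv_into_f inv_into_into)
    then have "map ?g ys \<in> args ar A f" using that(2) by (auto simp: args_def)
    note this hom[OF that(1) this] closed[OF that(1) this]
    moreover have "map h (map ?g ys) = ys" using g by (auto intro: map_idI)
    ultimately show ?thesis using h by (metis bij_betw_inv_into_left)
  qed
  with bij_betw_inv_into[OF h] show ?thesis unfolding isomorphic_def by blast
qed

section \<open>Substitutions as homomorphisms, and presented congruences\<close>

section \<open>Terms and substitutions\<close>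

lemma subst_subst: "subst \<sigma> (subst \<tau> t) = subst (\<lambda>i. subst \<sigma> (\<tau> i)) t"
  by (induction t) auto

lemma subst_Var [simp]: "subst Var t = t"
  by (induction t) (auto intro: map_idI)

lemma wf_subst:
  assumes "wf_tm ar X t" "\<And>i. i \<in> X \<Longrightarrow> wf_tm ar Y (\<sigma> i)"
  shows "wf_tm ar Y (subst \<sigma> t)"
  using assms
proof induction
  case (2 f ts)
  then show ?case by (auto intro!: wf_tm.intros(2))
qed simp

lemma subst_terms: "t \<in> terms ar k \<Longrightarrow> (\<And>i. \<sigma> i \<in> terms ar j) \<Longrightarrow> subst \<sigma> t \<in> terms ar j"
  using wf_subst[of ar "{..<k}" t "{..<j}" \<sigma>] by (simp add: terms_def)

lemma App_terms:
  "App f ts \<in> terms ar k \<longleftrightarrow> f < length ar \<and> length ts = ar ! f \<and> set ts \<subseteq> terms ar k"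
  by (auto simp: terms_def elim: wf_tm.cases intro: wf_tm.intros)

lemma term_alg_simps [simp]: "carrier (term_alg ar k) = terms ar k" "interp (term_alg ar k) = App"
  by (simp_all add: term_alg_def)

abbreviation tcong :: "signature \<Rightarrow> nat \<Rightarrow> (tm \<times> tm) set \<Rightarrow> bool" where
  "tcong ar k \<equiv> congruence ar (term_alg ar k)"

text \<open>Reduces generation of a whole quotient to its variables: once each variable is congruent
  to a term in the tuple, so is every term.\<close>

lemma congruence_subst:
  assumes "tcong ar k \<theta>" "wf_tm ar X t" "\<And>i. i \<in> X \<Longrightarrow> (\<sigma> i, \<tau> i) \<in> \<theta>"
  shows "(subst \<sigma> t, subst \<tau> t) \<in> \<theta>"
  using assms(2,3)
proof induction
  case (2 f ts)
  then have "list_all2 (\<lambda>x y. (x, y) \<in> \<theta>) (map (subst \<sigma>) ts) (map (subst \<tau>) ts)"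
    by (auto simp: list_all2_conv_all_nth)
  with congruence_interp[OF assms(1) 2(1)] 2(2) show ?case by simp
qed simp

text \<open>The kernel of the homomorphism from the terms over X_k into a quotient by
  \<open>\<theta>\<close> that sends the \<open>i\<close>-th variable to the class of
  \<open>\<sigma> i\<close>.\<close>

definition pullback :: "signature \<Rightarrow> nat \<Rightarrow> (nat \<Rightarrow> tm) \<Rightarrow> (tm \<times> tm) set \<Rightarrow> (tm \<times> tm) set" where
  "pullback ar k \<sigma> \<theta> = {(u, v) \<in> terms ar k \<times> terms ar k. (subst \<sigma> u, subst \<sigma> v) \<in> \<theta>}"

lemma congruence_pullback:
  assumes \<theta>: "tcong ar j \<theta>" and \<sigma>: "\<And>i. \<sigma> i \<in> terms ar j"
  shows "tcong ar k (pullback ar k \<sigma> \<theta>)"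
proof -
  have "equiv (terms ar k) (pullback ar k \<sigma> \<theta>)"
  proof (rule equivI)
    show "refl_on (terms ar k) (pullback ar k \<sigma> \<theta>)"
      using congruence_refl[OF \<theta>] subst_terms[OF _ \<sigma>] by (auto intro!: refl_onI simp: pullback_def)
    show "sym (pullback ar k \<sigma> \<theta>)"
      using congruence_sym[OF \<theta>] by (auto intro!: symI simp: pullback_def)
    show "trans (pullback ar k \<sigma> \<theta>)"
      using congruence_trans[OF \<theta>] by (auto intro!: transI simp: pullback_def)
  qed (auto simp: pullback_def)
  moreover have "(App f xs, App f ys) \<in> pullback ar k \<sigma> \<theta>"
    if "f < length ar" "xs \<in> args ar (term_alg ar k) f" "ys \<in> args ar (term_alg ar k) f"
      and l: "list_all2 (\<lambda>x y. (x, y) \<in> pullback ar k \<sigma> \<theta>) xs ys" for f xs ys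
  proof -
    have "list_all2 (\<lambda>x y. (x, y) \<in> \<theta>) (map (subst \<sigma>) xs) (map (subst \<sigma>) ys)"
      using l by (auto simp: list_all2_conv_all_nth pullback_def)
    then have "(App f (map (subst \<sigma>) xs), App f (map (subst \<sigma>) ys)) \<in> \<theta>"
      using congruence_interp[OF \<theta> that(1)] that(2) by (simp add: args_def)
    then show ?thesis using that by (simp add: pullback_def App_terms args_def)
  qed
  ultimately show ?thesis by (simp add: congruence_def)
qed

text \<open>Substituting into an instance of a law gives an instance under the composed
  substitution. Maps induced by tuples therefore respect the laws, and only relations have to be
  checked.\<close>

lemma law_instances_pullback:
  assumes "law_instances ar L j \<subseteq> \<theta>" "law_instances ar L k \<subseteq> terms ar k \<times> terms ar k"
    "\<And>i. \<sigma> i \<in> terms ar j"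
  shows "law_instances ar L k \<subseteq> pullback ar k \<sigma> \<theta>"
proof safe
  fix u v assume uv: "(u, v) \<in> law_instances ar L k"
  then obtain \<tau> s t where "u = subst \<tau> s" "v = subst \<tau> t" "(s, t) \<in> L" "\<And>i. \<tau> i \<in> terms ar k"
    unfolding law_instances_def by blast
  moreover from this have "subst \<sigma> (\<tau> i) \<in> terms ar j" for i
    using subst_terms assms(3) by blast
  ultimately have "(subst \<sigma> u, subst \<sigma> v) \<in> law_instances ar L j"
    unfolding law_instances_def
    by (intro CollectI exI[of _ "\<lambda>i. subst \<sigma> (\<tau> i)"] exI[of _ s] exI[of _ t]) (simp add: subst_subst)
  with assms uv show "(u, v) \<in> pullback ar k \<sigma> \<theta>" by (auto simp: pullback_def)
qed

lemma presentation_congruence: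
  assumes R: "R \<subseteq> terms ar k \<times> terms ar k" and L: "law_instances ar L k \<subseteq> terms ar k \<times> terms ar k"
  defines "\<theta> \<equiv> presentation_congruence ar L k R"
  shows "tcong ar k \<theta>" "R \<subseteq> \<theta>" "law_instances ar L k \<subseteq> \<theta>"
proof -
  let ?C = "{\<theta>. tcong ar k \<theta> \<and> R \<subseteq> \<theta> \<and> law_instances ar L k \<subseteq> \<theta>}"
  have \<theta>: "\<theta> = \<Inter>?C" unfolding \<theta>_def presentation_congruence_def by simp
  show "R \<subseteq> \<theta>" "law_instances ar L k \<subseteq> \<theta>" unfolding \<theta> by blast+
  \<comment> \<open>The total relation belongs to the intersected family and keeps the intersection
    inside the carrier.\<close>
  have "tcong ar k (terms ar k \<times> terms ar k)"
    by (auto simp: congruence_def equiv_def args_def App_terms intro!: refl_onI symI transI)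
  then have top: "terms ar k \<times> terms ar k \<in> ?C" using R L by blast
  have "equiv (terms ar k) \<theta>"
  proof (rule equivI)
    show "\<theta> \<subseteq> terms ar k \<times> terms ar k" unfolding \<theta> using top by blast
    show "refl_on (terms ar k) \<theta>"
      unfolding \<theta> by (auto intro!: refl_onI dest: congruence_refl)
    show "sym \<theta>" unfolding \<theta> by (auto intro!: symI dest: congruence_sym)
    show "trans \<theta>" unfolding \<theta> by (auto intro!: transI intro: congruence_trans)
  qed
  moreover have "(App f xs, App f ys) \<in> \<theta>"
    if "f < length ar" "xs \<in> args ar (term_alg ar k) f" "list_all2 (\<lambda>x y. (x, y) \<in> \<theta>) xs ys" for f xs ys
  proof -
    have "(App f xs, App f ys) \<in> \<psi>" if \<psi>: "\<psi> \<in> ?C" for \<psi>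
    proof -
      have "list_all2 (\<lambda>x y. (x, y) \<in> \<psi>) xs ys"
        using \<open>list_all2 _ xs ys\<close> by (rule list_all2_mono) (use \<theta> \<psi> in blast)
      then show ?thesis
        using congruence_interp[of ar "term_alg ar k" \<psi> f xs ys] \<psi> that(1) \<open>f < _\<close> \<open>xs \<in> _\<close>
        by (simp add: args_def)
    qed
    then show ?thesis unfolding \<theta> by blast
  qed
  ultimately show "tcong ar k \<theta>" by (simp add: congruence_def)
qed

lemma presentation_congruence_least:
  "tcong ar k \<theta> \<Longrightarrow> R \<subseteq> \<theta> \<Longrightarrow> law_instances ar L k \<subseteq> \<theta> \<Longrightarrow> presentation_congruence ar L k R \<subseteq> \<theta>"
  unfolding presentation_congruence_def by blast

section \<open>Invariance of generation, finite presentability and the Hopf property\<close>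

section \<open>Finitely generated algebras with the ascending chain condition\<close>

text \<open>The quotient of the terms over \<open>X\<^sub>k\<close> by \<open>\<theta>\<close> is generated by a \<open>j\<close>-tuple (the classes
  of \<open>\<sigma> i\<close>) which satisfies the relations \<open>F\<close>.\<close>

definition generated_by ::
    "signature \<Rightarrow> nat \<Rightarrow> (tm \<times> tm) set \<Rightarrow> nat \<Rightarrow> (tm \<times> tm) set \<Rightarrow> (nat \<Rightarrow> tm) \<Rightarrow> bool" where
  "generated_by ar j F k \<theta> \<sigma> \<longleftrightarrow> (\<forall>i. \<sigma> i \<in> terms ar k) \<and>
     (\<forall>t\<in>terms ar k. \<exists>u\<in>terms ar j. (subst \<sigma> u, t) \<in> \<theta>) \<and>
     (\<forall>(u, v)\<in>F. (subst \<sigma> u, subst \<sigma> v) \<in> \<theta>)"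

abbreviation tquot :: "signature \<Rightarrow> nat \<Rightarrow> (tm \<times> tm) set \<Rightarrow> tm set alg" where
  "tquot ar k \<equiv> quotient_alg (term_alg ar k)"

lemma tquot_closed:
  assumes "tcong ar k \<theta>" "f < length ar" "Cs \<in> args ar (tquot ar k \<theta>) f"
  shows "interp (tquot ar k \<theta>) f Cs \<in> carrier (tquot ar k \<theta>)"
proof -
  from assms(3) obtain ts where ts: "Cs = map (\<lambda>t. \<theta> `` {t}) ts" "set ts \<subseteq> terms ar k"
    by (auto simp: args_def quotient_alg_def elim!: quotient_list)
  then have args: "ts \<in> args ar (term_alg ar k) f" using assms(3) by (auto simp: args_def)
  show ?thesis
    using quotient_interp[OF assms(1,2) args] args assms(2) unfolding ts(1)
    by (auto simp: quotient_alg_def args_def App_terms intro!: quotientI)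
qed

text \<open>The isomorphism acts on classes, so the new tuple consists of chosen representatives of
  the images of the old one; agreement on generators then extends to all terms by induction.\<close>

lemma generated_by_isomorphic:
  assumes iso: "isomorphic ar (tquot ar k \<theta>) (tquot ar j \<psi>)"
    and \<theta>: "tcong ar k \<theta>" and \<psi>: "tcong ar j \<psi>"
    and F: "F \<subseteq> terms ar m \<times> terms ar m" and gen: "generated_by ar m F k \<theta> \<sigma>"
  obtains \<tau> where "generated_by ar m F j \<psi> \<tau>"
proof -
  let ?A = "\<lambda>t. \<theta> `` {t}" and ?B = "\<lambda>t. \<psi> `` {t}"
  obtain h where h: "bij_betw h (terms ar k // \<theta>) (terms ar j // \<psi>)"
    and hom: "\<And>f Cs. f < length ar \<Longrightarrow> Cs \<in> args ar (tquot ar k \<theta>) f \<Longrightarrow>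
      h (interp (tquot ar k \<theta>) f Cs) = interp (tquot ar j \<psi>) f (map h Cs)"
    using iso unfolding isomorphic_def by (auto simp: quotient_alg_def)
  from gen have \<sigma>: "\<And>i. \<sigma> i \<in> terms ar k"
    and onto: "\<And>t. t \<in> terms ar k \<Longrightarrow> \<exists>u\<in>terms ar m. (subst \<sigma> u, t) \<in> \<theta>"
    and rel: "\<And>u v. (u, v) \<in> F \<Longrightarrow> (subst \<sigma> u, subst \<sigma> v) \<in> \<theta>"
    unfolding generated_by_def by blast+
  have "\<exists>t\<in>terms ar j. h (?A s) = ?B t" if "s \<in> terms ar k" for s
  proof -
    have "h (?A s) \<in> terms ar j // \<psi>" using bij_betwE[OF h] quotientI[OF that, of \<theta>] by blast
    then show ?thesis by (rule quotientE) blast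
  qed
  then have "\<forall>i. \<exists>t. t \<in> terms ar j \<and> h (?A (\<sigma> i)) = ?B t" using \<sigma> by blast
  from choice[OF this] obtain \<tau> where \<tau>: "\<And>i. \<tau> i \<in> terms ar j" "\<And>i. h (?A (\<sigma> i)) = ?B (\<tau> i)"
    by blast
  have h_subst: "h (?A (subst \<sigma> u)) = ?B (subst \<tau> u)" if "u \<in> terms ar m" for u
    using that unfolding terms_def mem_Collect_eq
  proof induction
    case (1 i)
    then show ?case by (simp add: \<tau>)
  next
    case (2 f ts)
    then have ts: "set ts \<subseteq> terms ar m" by (auto simp: terms_def)
    have args: "map (subst \<sigma>) ts \<in> args ar (term_alg ar k) f"
      "map (subst \<tau>) ts \<in> args ar (term_alg ar j) f"
      using 2(2) ts subst_terms[OF _ \<sigma>] subst_terms[OF _ \<tau>(1)] by (auto simp: args_def)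
    have Cs: "map ?A (map (subst \<sigma>) ts) \<in> args ar (tquot ar k \<theta>) f"
      using args(1) by (auto simp: args_def quotient_alg_def intro!: quotientI)
    have "h (?A (subst \<sigma> (App f ts))) = h (interp (tquot ar k \<theta>) f (map ?A (map (subst \<sigma>) ts)))"
      using quotient_interp[OF \<theta> 2(1) args(1)] by simp
    also have "\<dots> = interp (tquot ar j \<psi>) f (map h (map ?A (map (subst \<sigma>) ts)))"
      by (rule hom[OF 2(1) Cs])
    also have "map h (map ?A (map (subst \<sigma>) ts)) = map ?B (map (subst \<tau>) ts)"
      using 2(3) by simp
    also have "interp (tquot ar j \<psi>) f \<dots> = ?B (subst \<tau> (App f ts))"
      using quotient_interp[OF \<psi> 2(1) args(2)] by simp
    finally show ?case .
  qed
  have "generated_by ar m F j \<psi> \<tau>"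
    unfolding generated_by_def
  proof (intro conjI ballI allI, rule \<tau>(1))
    fix t assume t: "t \<in> terms ar j"
    then have "?B t \<in> h ` (terms ar k // \<theta>)" using h by (simp add: bij_betw_def quotientI)
    then obtain s where s: "s \<in> terms ar k" "?B t = h (?A s)" by (auto elim!: quotientE)
    with onto obtain u where u: "u \<in> terms ar m" "(subst \<sigma> u, s) \<in> \<theta>" by blast
    then have "?A (subst \<sigma> u) = ?A s"
      using class_eq_iff[OF \<theta>] subst_terms[OF u(1) \<sigma>] by simp
    with s u have "?B (subst \<tau> u) = ?B t" using h_subst by metis
    then have "(subst \<tau> u, t) \<in> \<psi>"
      using class_eq_iff[OF \<psi>] subst_terms[OF u(1) \<tau>(1)] by simp
    with u show "\<exists>u\<in>terms ar m. (subst \<tau> u, t) \<in> \<psi>" by blast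
  next
    fix uv assume uv: "uv \<in> F"
    obtain u v where [simp]: "uv = (u, v)" by (cases uv)
    from uv F have mem: "u \<in> terms ar m" "v \<in> terms ar m" by auto
    have "?A (subst \<sigma> u) = ?A (subst \<sigma> v)"
      using rel uv class_eq_iff[OF \<theta>] subst_terms[OF mem(1) \<sigma>] by simp
    then have "?B (subst \<tau> u) = ?B (subst \<tau> v)" using h_subst mem by metis
    then show "case uv of (u, v) \<Rightarrow> (subst \<tau> u, subst \<tau> v) \<in> \<psi>"
      using class_eq_iff[OF \<psi>] subst_terms[OF mem(1) \<tau>(1)] by simp
  qed
  then show thesis by (rule that)
qed

text \<open>With the law instances for \<open>\<phi>\<close>, this is ACC for the free algebra on
  \<open>k\<close> generators, expressed by congruences of the term algebra.\<close>

definition chain_condition :: "signature \<Rightarrow> (tm \<times> tm) set \<Rightarrow> nat \<Rightarrow> bool" where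
  "chain_condition ar \<phi> k \<longleftrightarrow>
     (\<forall>\<theta>. (\<forall>n. tcong ar k (\<theta> n) \<and> \<phi> \<subseteq> \<theta> n \<and> \<theta> n \<subseteq> \<theta> (Suc n)) \<longrightarrow>
        (\<exists>N::nat. \<forall>n\<ge>N. \<theta> n = \<theta> N))"

text \<open>Initial segments of the relations generate an ascending chain of congruences. Where it
  stops, every later relation is already a consequence.\<close>

lemma finitely_presented:
  assumes ACC: "chain_condition ar (law_instances ar L k) k"
    and L: "law_instances ar L k \<subseteq> terms ar k \<times> terms ar k"
    and d: "\<And>n. d n \<in> terms ar k \<times> terms ar k"
  obtains N :: nat where
    "presentation_congruence ar L k (d ` (S \<inter> {..<N})) = presentation_congruence ar L k (d ` S)"
proof -
  let ?\<theta> = "\<lambda>n. presentation_congruence ar L k (d ` (S \<inter> {..<n}))"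
  note \<theta> = presentation_congruence[OF _ L]
  have R: "d ` S' \<subseteq> terms ar k \<times> terms ar k" for S' using d by blast
  have "?\<theta> n \<subseteq> presentation_congruence ar L k (d ` S)" for n
    using \<theta>[OF R[of S]] by (intro presentation_congruence_least) auto
  moreover have "?\<theta> n \<subseteq> ?\<theta> (Suc n)" for n
    using \<theta>[OF R[of "S \<inter> {..<Suc n}"]] by (intro presentation_congruence_least) auto
  then obtain N where N: "\<forall>n\<ge>N. ?\<theta> n = ?\<theta> N"
    using ACC[unfolded chain_condition_def, rule_format, of ?\<theta>] \<theta>(1,3)[OF R] by blast
  have "d ` S \<subseteq> ?\<theta> N"
  proof
    fix r assume "r \<in> d ` S"
    then obtain n where "r = d n" "n \<in> S" by blast
    \<comment> \<open>The stage must be past the stopping point and also past the relation numbered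
      \<open>n\<close>.\<close>
    then have "r \<in> ?\<theta> (max N (Suc n))"
      using \<theta>(2)[OF R[of "S \<inter> {..<max N (Suc n)}"]] by auto
    with N show "r \<in> ?\<theta> N" by (metis max.cobounded1)
  qed
  then have "presentation_congruence ar L k (d ` S) \<subseteq> ?\<theta> N"
    using \<theta>[OF R] by (intro presentation_congruence_least) auto
  ultimately show thesis using that by blast
qed

lemma pullback_mono: "\<theta> \<subseteq> \<psi> \<Longrightarrow> pullback ar k \<sigma> \<theta> \<subseteq> pullback ar k \<sigma> \<psi>"
  by (auto simp: pullback_def)

text \<open>Let the kernels of the powers be constant from \<open>N\<close> on. Two elements with
  equal image are \<open>N\<close>-fold images, by surjectivity; their preimages are identified by
  power \<open>N + 1\<close>, hence by power \<open>N\<close>, so the two elements were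
  equal.\<close>

lemma hopfian:
  assumes ACC: "chain_condition ar \<phi> k" and \<theta>: "tcong ar k \<theta>" and "\<phi> \<subseteq> \<theta>"
    and \<rho>: "\<And>i. \<rho> i \<in> terms ar k"
    and resp: "\<theta> \<subseteq> pullback ar k \<rho> \<theta>"
    and onto: "\<And>t. t \<in> terms ar k \<Longrightarrow> \<exists>u\<in>terms ar k. (subst \<rho> u, t) \<in> \<theta>"
  shows "pullback ar k \<rho> \<theta> = \<theta>"
proof
  \<comment> \<open>The kernel of the \<open>n\<close>-th power of the endomorphism. As an iterated
    pullback it is a congruence by induction; \<open>\<kappa>_iff\<close> gives the description by
    powers.\<close>
  define \<kappa> where "\<kappa> n = (pullback ar k \<rho> ^^ n) \<theta>" for n
  define r where "r n = subst \<rho> ^^ n" for n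
  have r_mem: "r n u \<in> terms ar k" if "u \<in> terms ar k" for n u
    by (induction n) (auto simp: r_def that subst_terms \<rho>)
  have \<kappa>_cong: "tcong ar k (\<kappa> n)" for n
    by (induction n) (auto simp: \<kappa>_def \<theta> intro: congruence_pullback \<rho>)
  have \<kappa>_Suc: "\<kappa> n \<subseteq> \<kappa> (Suc n)" for n
    by (induction n) (use resp in \<open>auto simp: \<kappa>_def dest: subsetD[OF pullback_mono]\<close>)
  have "\<theta> \<subseteq> \<kappa> n" for n
    using lift_Suc_mono_le[of \<kappa> 0 n, OF \<kappa>_Suc] by (simp add: \<kappa>_def)
  then obtain N where N: "\<forall>n\<ge>N. \<kappa> n = \<kappa> N"
    using ACC[unfolded chain_condition_def, rule_format, of \<kappa>] \<kappa>_cong \<kappa>_Suc \<open>\<phi> \<subseteq> \<theta>\<close> by blast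
  have \<kappa>_iff: "(u, v) \<in> \<kappa> n \<longleftrightarrow> (r n u, r n v) \<in> \<theta>" if "u \<in> terms ar k" "v \<in> terms ar k" for n u v
    using that
  proof (induction n arbitrary: u v)
    case 0
    then show ?case by (simp add: \<kappa>_def r_def)
  next
    case (Suc n)
    from Suc.prems have "(u, v) \<in> \<kappa> (Suc n) \<longleftrightarrow> (subst \<rho> u, subst \<rho> v) \<in> \<kappa> n"
      by (simp add: \<kappa>_def pullback_def)
    also have "\<dots> \<longleftrightarrow> (r n (subst \<rho> u), r n (subst \<rho> v)) \<in> \<theta>"
      by (intro Suc.IH subst_terms[OF Suc.prems(1) \<rho>] subst_terms[OF Suc.prems(2) \<rho>])
    finally show ?case by (simp add: r_def funpow_swap1)
  qed
  have r_onto: "\<exists>u\<in>terms ar k. (r n u, t) \<in> \<theta>" if "t \<in> terms ar k" for n t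
    using that
  proof (induction n arbitrary: t)
    case 0
    then show ?case using congruence_refl[OF \<theta>] by (auto simp: r_def)
  next
    case (Suc n)
    from onto[OF Suc.prems] obtain s where s: "s \<in> terms ar k" "(subst \<rho> s, t) \<in> \<theta>" by blast
    from Suc.IH[OF s(1)] obtain u where u: "u \<in> terms ar k" "(r n u, s) \<in> \<theta>" by blast
    with resp have "(subst \<rho> (r n u), subst \<rho> s) \<in> \<theta>" by (auto simp: pullback_def)
    with s have "(r (Suc n) u, t) \<in> \<theta>" using congruence_trans[OF \<theta>] by (auto simp: r_def)
    with u show ?case by blast
  qed
  show "pullback ar k \<rho> \<theta> \<subseteq> \<theta>"
  proof safe
    fix u v assume "(u, v) \<in> pullback ar k \<rho> \<theta>"
    then have uv: "u \<in> terms ar k" "v \<in> terms ar k" "(u, v) \<in> pullback ar k \<rho> \<theta>"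
      by (auto simp: pullback_def)
    obtain u' v' where u': "u' \<in> terms ar k" "(r N u', u) \<in> \<theta>"
      and v': "v' \<in> terms ar k" "(r N v', v) \<in> \<theta>"
      using r_onto uv by meson
    have "tcong ar k (pullback ar k \<rho> \<theta>)" by (rule congruence_pullback[OF \<theta> \<rho>])
    note sym = congruence_sym[OF this] and trans = congruence_trans[OF this]
    have "(r N u', r N v') \<in> pullback ar k \<rho> \<theta>"
      using u' v' uv resp sym trans by (meson subsetD)
    then have "(u', v') \<in> \<kappa> (Suc N)"
      using \<kappa>_iff[OF u'(1) v'(1)] by (simp add: pullback_def r_def)
    then have "(u', v') \<in> \<kappa> N" using N by (metis le_SucI order_refl)
    then have "(r N u', r N v') \<in> \<theta>" using \<kappa>_iff[OF u'(1) v'(1)] by simp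
    with u' v' show "(u, v) \<in> \<theta>"
      using congruence_sym[OF \<theta>] congruence_trans[OF \<theta>] by meson
  qed
qed (rule resp)

text \<open>Because \<open>F\<close> and \<open>G\<close> present the two algebras, each tuple
  induces a homomorphism, by minimality of the presented congruence. The Hopf property of the first
  algebra then makes the map induced by \<open>\<sigma>\<close> injective.\<close>

lemma isomorphic_if_generated_by:
  assumes ACC: "chain_condition ar (law_instances ar L k) k"
    and L: "\<And>k. law_instances ar L k \<subseteq> terms ar k \<times> terms ar k"
    and F: "F \<subseteq> terms ar k \<times> terms ar k" and G: "G \<subseteq> terms ar j \<times> terms ar j"
  defines "\<theta> \<equiv> presentation_congruence ar L k F" and "\<psi> \<equiv> presentation_congruence ar L j G"
  assumes \<sigma>: "generated_by ar k F j \<psi> \<sigma>" and \<tau>: "generated_by ar j G k \<theta> \<tau>"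
  shows "isomorphic ar (tquot ar k \<theta>) (tquot ar j \<psi>)"
proof -
  note \<theta> = presentation_congruence[OF F L, folded \<theta>_def]
  note \<psi> = presentation_congruence[OF G L, folded \<psi>_def]
  have \<sigma>_mem: "\<And>i. \<sigma> i \<in> terms ar j" and \<tau>_mem: "\<And>i. \<tau> i \<in> terms ar k"
    using \<sigma> \<tau> unfolding generated_by_def by blast+
  have \<sigma>_resp: "\<theta> \<subseteq> pullback ar k \<sigma> \<psi>"
    unfolding \<theta>_def
  proof (rule presentation_congruence_least[OF congruence_pullback[OF \<psi>(1) \<sigma>_mem] _
        law_instances_pullback[OF \<psi>(3) L \<sigma>_mem]])
    show "F \<subseteq> pullback ar k \<sigma> \<psi>"
      using \<sigma> F by (auto simp: generated_by_def pullback_def)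
  qed
  have \<tau>_resp: "\<psi> \<subseteq> pullback ar j \<tau> \<theta>"
    unfolding \<psi>_def
  proof (rule presentation_congruence_least[OF congruence_pullback[OF \<theta>(1) \<tau>_mem] _
        law_instances_pullback[OF \<theta>(3) L \<tau>_mem]])
    show "G \<subseteq> pullback ar j \<tau> \<theta>"
      using \<tau> G by (auto simp: generated_by_def pullback_def)
  qed
  define \<rho> where "\<rho> i = subst \<tau> (\<sigma> i)" for i
  have \<rho>: "subst \<rho> u = subst \<tau> (subst \<sigma> u)" for u
    unfolding \<rho>_def by (simp add: subst_subst)
  have "pullback ar k \<rho> \<theta> = \<theta>"
  proof (rule hopfian[OF ACC \<theta>(1,3)])
    show "\<rho> i \<in> terms ar k" for i unfolding \<rho>_def by (rule subst_terms[OF \<sigma>_mem \<tau>_mem])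
    show "\<theta> \<subseteq> pullback ar k \<rho> \<theta>"
      using \<sigma>_resp \<tau>_resp by (auto simp: pullback_def \<rho>)
    show "\<exists>u\<in>terms ar k. (subst \<rho> u, t) \<in> \<theta>" if t: "t \<in> terms ar k" for t
    proof -
      from \<tau> t obtain v where v: "v \<in> terms ar j" "(subst \<tau> v, t) \<in> \<theta>"
        unfolding generated_by_def by blast
      from \<sigma> v(1) obtain u where u: "u \<in> terms ar k" "(subst \<sigma> u, v) \<in> \<psi>"
        unfolding generated_by_def by blast
      with \<tau>_resp have "(subst \<rho> u, subst \<tau> v) \<in> \<theta>" by (auto simp: pullback_def \<rho>)
      with v u show ?thesis using congruence_trans[OF \<theta>(1)] by blast
    qed
  qed
  \<comment> \<open>Whatever \<open>\<sigma>\<close> identifies is identified by the composite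
    \<open>\<rho>\<close>, whose kernel is just \<open>\<theta>\<close>.\<close>
  then have inj: "(u, v) \<in> \<theta>"
    if "u \<in> terms ar k" "v \<in> terms ar k" "(subst \<sigma> u, subst \<sigma> v) \<in> \<psi>" for u v
    using that \<tau>_resp by (auto simp: pullback_def \<rho>)
  let ?A = "\<lambda>t. \<theta> `` {t}" and ?B = "\<lambda>t. \<psi> `` {t}"
  \<comment> \<open>Saturating the image of a whole class avoids a choice of
    representatives.\<close>
  define h where "h C = \<psi> `` (subst \<sigma> ` C)" for C
  have h: "h (?A u) = ?B (subst \<sigma> u)" if "u \<in> terms ar k" for u
  proof -
    have "(subst \<sigma> u, subst \<sigma> v) \<in> \<psi>" if "(u, v) \<in> \<theta>" for v
      using that \<sigma>_resp by (auto simp: pullback_def)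
    moreover have "(u, u) \<in> \<theta>" using congruence_refl[OF \<theta>(1)] that by simp
    ultimately show ?thesis unfolding h_def using congruence_trans[OF \<psi>(1)] by blast
  qed
  have mem: "subst \<sigma> u \<in> terms ar j" if "u \<in> terms ar k" for u
    using that by (rule subst_terms) (rule \<sigma>_mem)
  have "bij_betw h (terms ar k // \<theta>) (terms ar j // \<psi>)"
    unfolding bij_betw_def
  proof
    show "inj_on h (terms ar k // \<theta>)"
    proof (rule inj_onI)
      fix C D assume "C \<in> terms ar k // \<theta>" "D \<in> terms ar k // \<theta>" and eq: "h C = h D"
      then obtain u v where uv: "C = ?A u" "u \<in> terms ar k" "D = ?A v" "v \<in> terms ar k"
        by (auto elim!: quotientE)
      with eq h have "?B (subst \<sigma> u) = ?B (subst \<sigma> v)" by simp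
      then have "(subst \<sigma> u, subst \<sigma> v) \<in> \<psi>" using class_eq_iff[OF \<psi>(1)] mem uv by simp
      with inj uv show "C = D" using class_eq_iff[OF \<theta>(1)] by simp
    qed
    show "h ` (terms ar k // \<theta>) = terms ar j // \<psi>"
    proof
      show "h ` (terms ar k // \<theta>) \<subseteq> terms ar j // \<psi>"
        using h by (auto elim!: quotientE intro!: quotientI mem)
      show "terms ar j // \<psi> \<subseteq> h ` (terms ar k // \<theta>)"
      proof
        fix D assume "D \<in> terms ar j // \<psi>"
        then obtain v where v: "D = ?B v" "v \<in> terms ar j" by (auto elim!: quotientE)
        with \<sigma> obtain u where u: "u \<in> terms ar k" "(subst \<sigma> u, v) \<in> \<psi>"
          unfolding generated_by_def by blast
        then have "h (?A u) = D" using h v class_eq_iff[OF \<psi>(1)] mem by simp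
        with u show "D \<in> h ` (terms ar k // \<theta>)" by (blast intro: quotientI)
      qed
    qed
  qed
  moreover have "h (interp (tquot ar k \<theta>) f Cs) = interp (tquot ar j \<psi>) f (map h Cs)"
    if f: "f < length ar" and "Cs \<in> args ar (tquot ar k \<theta>) f" for f Cs
  proof -
    from that(2) obtain ts where ts: "Cs = map ?A ts" "set ts \<subseteq> terms ar k"
      by (auto simp: args_def quotient_alg_def elim!: quotient_list)
    then have args: "ts \<in> args ar (term_alg ar k) f" "map (subst \<sigma>) ts \<in> args ar (term_alg ar j) f"
      using that(2) mem by (auto simp: args_def)
    then have "App f ts \<in> terms ar k" using f by (simp add: args_def App_terms)
    then have "h (interp (tquot ar k \<theta>) f Cs) = ?B (App f (map (subst \<sigma>) ts))"
      using quotient_interp[OF \<theta>(1) f args(1)] ts(1) h by simp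
    also have "\<dots> = interp (tquot ar j \<psi>) f (map ?B (map (subst \<sigma>) ts))"
      using quotient_interp[OF \<psi>(1) f args(2)] by simp
    also have "map ?B (map (subst \<sigma>) ts) = map h Cs"
      using ts h by auto
    finally show ?thesis .
  qed
  moreover have "carrier (tquot ar m \<chi>) = terms ar m // \<chi>" for m \<chi>
    by (simp add: quotient_alg_def)
  ultimately show ?thesis unfolding isomorphic_def by (intro exI[of _ h]) simp
qed

section \<open>Substitution and equational logic as calculi on codes\<close>

section \<open>Derivability in a presentation is semidecidable\<close>

lemma tm_num_inj: "tm_num s = tm_num t \<Longrightarrow> s = t"
proof (induction s arbitrary: t)
  case (Var i)
  then show ?case by (cases t) auto
next
  case (App f ss)
  then obtain ts where t: "t = App f ts" and eq: "map tm_num ss = map tm_num ts"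
    by (cases t) (auto simp: list_encode_eq)
  have "ss = ts"
    by (rule list.inj_map_strong[OF _ eq]) (use App.IH in blast)
  with t show ?case by simp
qed

lemma tm_num_eq_iff [simp]: "tm_num s = tm_num t \<longleftrightarrow> s = t"
  using tm_num_inj by blast

lemma tm_num_Var_iff: "tm_num t = \<langle>0, i\<rangle> \<longleftrightarrow> t = Var i"
  by (cases t) auto

text \<open>A law may use any variables, but only finitely many; finite lists can therefore code the
  substitutions that matter.\<close>

primrec vars :: "tm \<Rightarrow> nat set" where
  "vars (Var i) = {i}"
| "vars (App f ts) = \<Union>(set (map vars ts))"

lemma finite_vars: "finite (vars t)"
  by (induction t) auto

lemma wf_tm_vars: "wf_tm ar X t \<Longrightarrow> vars t \<subseteq> X"
  by (induction rule: wf_tm.induct) auto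

lemma subst_cong: "(\<And>i. i \<in> vars t \<Longrightarrow> \<sigma> i = \<tau> i) \<Longrightarrow> subst \<sigma> t = subst \<tau> t"
  by (induction t) auto

text \<open>Judgements on terms and on argument lists, in a context \<open>a\<close>,
  \<open>b\<close>. List judgements break operations of any arity into steps with two premises; the
  calculi for substitution and for equality share this encoding.\<close>

definition tj :: "nat \<Rightarrow> nat \<Rightarrow> nat \<Rightarrow> nat \<Rightarrow> nat" where "tj a b x y = \<langle>0, \<langle>\<langle>a, b\<rangle>, \<langle>x, y\<rangle>\<rangle>\<rangle>"
definition lj :: "nat \<Rightarrow> nat \<Rightarrow> nat \<Rightarrow> nat \<Rightarrow> nat" where "lj a b x y = \<langle>1, \<langle>\<langle>a, b\<rangle>, \<langle>x, y\<rangle>\<rangle>\<rangle>"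

lemma judgement_eq [simp]:
  "tj a b x y = tj a' b' x' y' \<longleftrightarrow> a = a' \<and> b = b' \<and> x = x' \<and> y = y'"
  "lj a b x y = lj a' b' x' y' \<longleftrightarrow> a = a' \<and> b = b' \<and> x = x' \<and> y = y'"
  "tj a b x y \<noteq> lj a' b' x' y'" "lj a b x y \<noteq> tj a' b' x' y'"
  by (simp_all add: tj_def lj_def)

lemma computable_judgement [computable_intros]:
  assumes "computable a" "computable b" "computable x" "computable y"
  shows "computable (\<lambda>z. tj (a z) (b z) (x z) (y z))" "computable (\<lambda>z. lj (a z) (b z) (x z) (y z))"
  unfolding tj_def lj_def by (intro computable_intros assms)+

text \<open>Fixes witnesses \<open>g\<close> and \<open>laws\<close> for the effectiveness
  assumptions, so that the rules of the calculi can mention them.\<close>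

locale coded_variety =
  fixes ar :: signature and L :: "(tm \<times> tm) set" and \<delta> :: "nat \<Rightarrow> nat \<Rightarrow> tm \<times> tm"
    and g :: "nat \<Rightarrow> nat" and laws :: nat
  assumes wf_laws: "\<And>s t. (s, t) \<in> L \<Longrightarrow> wf_tm ar UNIV s \<and> wf_tm ar UNIV t"
    and W_laws: "W laws = tm_pair_num ` L"
    and range_\<delta>: "\<And>k. k \<ge> 1 \<Longrightarrow> range (\<delta> k) = terms ar k \<times> terms ar k"
    and computable_g: "computable g"
    and g_\<delta>: "\<And>k n. k \<ge> 1 \<Longrightarrow> g \<langle>k, n\<rangle> = tm_pair_num (\<delta> k n)"
begin

lemma computable_g_comp: "computable f \<Longrightarrow> computable (\<lambda>x. g (f x))"
  by (rule computable_comp[OF computable_g])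

lemma \<delta>_terms: "k \<ge> 1 \<Longrightarrow> \<delta> k n \<in> terms ar k \<times> terms ar k"
  using range_\<delta> by blast

lemma \<delta>_image: "k \<ge> 1 \<Longrightarrow> \<delta> k ` S \<subseteq> terms ar k \<times> terms ar k"
  using \<delta>_terms by blast

lemma law_instances_terms: "law_instances ar L k \<subseteq> terms ar k \<times> terms ar k"
  unfolding law_instances_def terms_def using wf_laws by (auto intro!: wf_subst[of ar UNIV])

lemma Var0_terms: "k \<ge> 1 \<Longrightarrow> Var 0 \<in> terms ar k"
  by (auto simp: terms_def intro: wf_tm.intros)

text \<open>Since \<open>\<delta> k\<close> reaches all pairs of terms, the first components of its
  values enumerate the codes of terms, and no parser is written.\<close>

definition code_wf :: "nat \<Rightarrow> nat \<Rightarrow> bool" where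
  "code_wf k s \<longleftrightarrow> (\<exists>n. p1 (g \<langle>k, n\<rangle>) = s)"

lemma code_wf_iff:
  assumes "k \<ge> 1"
  shows "code_wf k s \<longleftrightarrow> (\<exists>t\<in>terms ar k. s = tm_num t)"
proof
  assume "code_wf k s"
  then obtain n where "p1 (tm_pair_num (\<delta> k n)) = s" unfolding code_wf_def using g_\<delta>[OF assms] by auto
  with \<delta>_terms[OF assms, of n] show "\<exists>t\<in>terms ar k. s = tm_num t"
    by (auto simp: tm_pair_num_def split: prod.splits)
next
  assume "\<exists>t\<in>terms ar k. s = tm_num t"
  then obtain t where t: "t \<in> terms ar k" "s = tm_num t" by blast
  then have "(t, t) \<in> range (\<delta> k)" using range_\<delta>[OF assms] by blast
  then obtain n where "\<delta> k n = (t, t)" by (metis rangeE)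
  with t show "code_wf k s"
    unfolding code_wf_def g_\<delta>[OF assms] by (intro exI[of _ n]) (simp add: tm_pair_num_def)
qed

lemma semidec_code_wf:
  assumes "computable f" "computable h"
  shows "semidec (\<lambda>x. code_wf (f x) (h x))"
  unfolding code_wf_def
  by (intro semidec_intros computable_intros computable_g_comp
      computable_comp[OF assms(1)] computable_comp[OF assms(2)])

text \<open>\<open>\<langle>0, i\<rangle>\<close> is the code of \<open>Var i\<close>, and 0 that of
  the empty list. The guard lets only codes of terms over X_k be substituted, when
  \<open>k \<ge> 1\<close>.\<close>

inductive sub_base :: "nat \<Rightarrow> bool" where
  "code_wf k (entry l i) \<Longrightarrow> sub_base (tj k l \<langle>0, i\<rangle> (entry l i))"
| "sub_base (lj k l 0 0)"

inductive sub_step :: "nat \<Rightarrow> nat \<Rightarrow> nat \<Rightarrow> bool" where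
  "sub_step (tj k l x y) (lj k l xs ys) (lj k l (Suc \<langle>x, xs\<rangle>) (Suc \<langle>y, ys\<rangle>))"
| "sub_step (lj k l xs ys) (lj k l xs ys) (tj k l \<langle>Suc f, xs\<rangle> \<langle>Suc f, ys\<rangle>)"

definition Sub :: "nat \<Rightarrow> nat \<Rightarrow> nat \<Rightarrow> nat \<Rightarrow> bool" where
  "Sub k l x y \<longleftrightarrow> clos sub_base sub_step (tj k l x y)"

text \<open>The default makes the substitution coded by any \<open>l\<close> take values in the terms over \<open>X\<^sub>k\<close>.\<close>

definition env :: "nat \<Rightarrow> nat \<Rightarrow> nat \<Rightarrow> tm" where
  "env k l i = (if code_wf k (entry l i) then SOME t. t \<in> terms ar k \<and> entry l i = tm_num t else Var 0)"

lemma env_code: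
  assumes "k \<ge> 1" "code_wf k (entry l i)"
  shows "env k l i \<in> terms ar k" "tm_num (env k l i) = entry l i"
proof -
  have "env k l i \<in> terms ar k \<and> entry l i = tm_num (env k l i)"
    using assms unfolding env_def by (auto simp: code_wf_iff intro: someI2)
  then show "env k l i \<in> terms ar k" "tm_num (env k l i) = entry l i" by auto
qed

lemma env_terms: "k \<ge> 1 \<Longrightarrow> env k l i \<in> terms ar k"
  using env_code(1) Var0_terms by (cases "code_wf k (entry l i)") (auto simp: env_def)

text \<open>Holds for arbitrary \<open>l\<close>: a derivation uses only entries that pass the
  guard, and at these \<open>env\<close> has the entry as its code.\<close>

lemma Sub_sound:
  assumes "k \<ge> 1" "Sub k l (tm_num t) y"
  shows "y = tm_num (subst (env k l) t)"
proof -
  have "(\<forall>t y. c = tj k l (tm_num t) y \<longrightarrow> y = tm_num (subst (env k l) t)) \<and>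
     (\<forall>ts y. c = lj k l (list_encode (map tm_num ts)) y \<longrightarrow>
        y = list_encode (map tm_num (map (subst (env k l)) ts)))"
    if "clos sub_base sub_step c" for c
    using that
  proof induction
    case (base c)
    then show ?case
    proof cases
      case (1 k' l' i)
      with env_code(2)[OF assms(1), of l i] show ?thesis
        by (auto simp: tm_num_Var_iff eq_commute[of "\<langle>0, i\<rangle>"])
    next
      case (2 k' l')
      have "list_encode (map tm_num ts) = 0 \<longleftrightarrow> ts = []" for ts by (cases ts) auto
      with 2 show ?thesis by auto
    qed
  next
    case (step a b c)
    from step.hyps(1) show ?case
    proof cases
      case (1 k' l' x y xs ys)
      show ?thesis
      proof (intro conjI allI impI)
        fix ts z assume "c = lj k l (list_encode (map tm_num ts)) z"
        with 1 have c: "list_encode (map tm_num ts) = Suc \<langle>x, xs\<rangle>" "z = Suc \<langle>y, ys\<rangle>"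
          and a: "a = tj k l x y" and b: "b = lj k l xs ys" by auto
        from c(1) obtain t ts' where ts: "ts = t # ts'" "x = tm_num t" "xs = list_encode (map tm_num ts')"
          by (cases ts) auto
        from step.IH(1) a ts have "y = tm_num (subst (env k l) t)" by blast
        moreover from step.IH(2) b ts have "ys = list_encode (map tm_num (map (subst (env k l)) ts'))"
          by blast
        ultimately show "z = list_encode (map tm_num (map (subst (env k l)) ts))"
          using c(2) ts(1) by simp
      qed (use 1 in auto)
    next
      case (2 k' l' xs ys f)
      show ?thesis
      proof (intro conjI allI impI)
        fix t z assume "c = tj k l (tm_num t) z"
        with 2 have c: "tm_num t = \<langle>Suc f, xs\<rangle>" "z = \<langle>Suc f, ys\<rangle>" and a: "a = lj k l xs ys" by auto
        from c(1) obtain ts where t: "t = App f ts" "xs = list_encode (map tm_num ts)"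
          by (cases t) auto
        from step.IH(1) a t have "ys = list_encode (map tm_num (map (subst (env k l)) ts))" by blast
        with c(2) t(1) show "z = tm_num (subst (env k l) t)" by simp
      qed (use 2 in auto)
    qed
  qed
  then show ?thesis using assms unfolding Sub_def by blast
qed

lemma Sub_complete:
  assumes "k \<ge> 1" "\<And>i. i \<in> vars t \<Longrightarrow> \<sigma> i \<in> terms ar k \<and> entry l i = tm_num (\<sigma> i)"
  shows "Sub k l (tm_num t) (tm_num (subst \<sigma> t))"
  using assms(2)
proof (induction t)
  case (Var i)
  then have i: "code_wf k (entry l i)" "tm_num (\<sigma> i) = entry l i"
    using code_wf_iff[OF assms(1)] by auto
  from clos.base[of sub_base, OF sub_base.intros(1)[OF i(1)]] show ?case
    unfolding Sub_def by (simp add: i(2))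
next
  case (App f ts)
  have "set ss \<subseteq> set ts \<Longrightarrow> clos sub_base sub_step
    (lj k l (list_encode (map tm_num ss)) (list_encode (map tm_num (map (subst \<sigma>) ss))))" for ss
  proof (induction ss)
    case Nil
    show ?case by (simp add: clos.base sub_base.intros)
  next
    case (Cons s ss)
    then have "Sub k l (tm_num s) (tm_num (subst \<sigma> s))" using App by auto
    with Cons show ?case
      unfolding Sub_def by (simp add: clos.step[where R = sub_step, OF sub_step.intros(1)])
  qed
  from this[OF subset_refl] show ?case
    unfolding Sub_def by (simp add: clos.step[where R = sub_step, OF sub_step.intros(2)])
qed

lemma semidec_Sub:
  assumes "computable a" "computable b" "computable x" "computable y"
  shows "semidec (\<lambda>z. Sub (a z) (b z) (x z) (y z))"
proof -
  have "semidec sub_base"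
    by (rule semidec_cong[OF sub_base.simps])
      (intro semidec_intros computable_intros semidec_code_wf)
  moreover have "semidec (\<lambda>z. sub_step (p1 z) (p1 (p2 z)) (p2 (p2 z)))"
    by (rule semidec_cong[OF sub_step.simps]) (intro semidec_intros computable_intros)
  ultimately have "semidec (clos sub_base sub_step)" by (rule semidec_clos)
  from semidec_comp[OF this computable_judgement(1)[OF assms]] show ?thesis
    unfolding Sub_def .
qed

inductive eq_base :: "nat \<Rightarrow> bool" where
  "code_wf k s \<Longrightarrow> eq_base (tj k e s s)"
| "n \<in> W e \<Longrightarrow> eq_base (tj k e (p1 (g \<langle>k, n\<rangle>)) (p2 (g \<langle>k, n\<rangle>)))"
| "\<langle>s, t\<rangle> \<in> W laws \<Longrightarrow> Sub k l s s' \<Longrightarrow> Sub k l t t' \<Longrightarrow> eq_base (tj k e s' t')"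
| "eq_base (lj k e 0 0)"

text \<open>The guard in the rule for operations ensures a valid symbol with the right number of
  arguments on the left; the list judgement forces the same length on the right.\<close>

inductive eq_step :: "nat \<Rightarrow> nat \<Rightarrow> nat \<Rightarrow> bool" where
  "eq_step (tj k e x y) (lj k e xs ys) (lj k e (Suc \<langle>x, xs\<rangle>) (Suc \<langle>y, ys\<rangle>))"
| "code_wf k \<langle>Suc f, xs\<rangle> \<Longrightarrow>
     eq_step (lj k e xs ys) (lj k e xs ys) (tj k e \<langle>Suc f, xs\<rangle> \<langle>Suc f, ys\<rangle>)"
| "eq_step (tj k e x y) (tj k e x y) (tj k e y x)"
| "eq_step (tj k e x y) (tj k e y z) (tj k e x z)"

definition Eq :: "nat \<Rightarrow> nat \<Rightarrow> nat \<Rightarrow> nat \<Rightarrow> bool" where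
  "Eq k e x y \<longleftrightarrow> clos eq_base eq_step (tj k e x y)"

definition cong :: "nat \<Rightarrow> nat \<Rightarrow> (tm \<times> tm) set" where
  "cong k e = presentation_congruence ar L k (\<delta> k ` W e)"

lemma cong:
  assumes "k \<ge> 1"
  shows "tcong ar k (cong k e)" "\<delta> k ` W e \<subseteq> cong k e" "law_instances ar L k \<subseteq> cong k e"
  unfolding cong_def
  by (intro presentation_congruence law_instances_terms; rule \<delta>_image[OF assms])+

text \<open>That derivable numbers are codes of terms belongs to the induction: transitivity passes
  through a number that must be decoded to the same term on both sides.\<close>

lemma Eq_sound:
  assumes "k \<ge> 1" "Eq k e x y"
  shows "\<exists>s t. x = tm_num s \<and> y = tm_num t \<and> (s, t) \<in> cong k e"
proof -
  note C = cong[OF assms(1), of e]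
  let ?T = "\<lambda>x y. \<exists>s t. x = tm_num s \<and> y = tm_num t \<and> (s, t) \<in> cong k e"
  let ?L = "\<lambda>x y. \<exists>ss ts. x = list_encode (map tm_num ss) \<and> y = list_encode (map tm_num ts) \<and>
    list_all2 (\<lambda>s t. (s, t) \<in> cong k e) ss ts"
  have "(\<forall>x y. c = tj k e x y \<longrightarrow> ?T x y) \<and> (\<forall>x y. c = lj k e x y \<longrightarrow> ?L x y)"
    if "clos eq_base eq_step c" for c
    using that
  proof induction
    case (base c)
    then show ?case
    proof cases
      case (1 k' s e')
      with code_wf_iff[OF assms(1)] congruence_refl[OF C(1)] show ?thesis by auto
    next
      case (2 n e' k')
      obtain s t where st: "\<delta> k n = (s, t)" by (cases "\<delta> k n")
      then have "(s, t) \<in> cong k e" if "n \<in> W e" using C(2) that by force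
      with 2 st show ?thesis by (auto simp: g_\<delta>[OF assms(1)] tm_pair_num_def)
    next
      case (3 s t k' l s' t' e')
      then obtain u v where uv: "(u, v) \<in> L" "s = tm_num u" "t = tm_num v"
        by (auto simp: W_laws tm_pair_num_def)
      have "(subst (env k l) u, subst (env k l) v) \<in> cong k e"
        using C(3) uv env_terms[OF assms(1)] unfolding law_instances_def by blast
      moreover have "s' = tm_num (subst (env k l) u)" "t' = tm_num (subst (env k l) v)" if "k' = k"
        using 3 uv that Sub_sound[OF assms(1)] by auto
      ultimately show ?thesis using 3(1) by auto
    next
      case (4 k' e')
      then show ?thesis by (auto intro!: exI[of _ "[]"])
    qed
  next
    case (step a b c)
    from step.hyps(1) show ?case
    proof cases
      case (1 k' e' x y xs ys)
      show ?thesis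
      proof (intro conjI allI impI)
        fix u v assume "c = lj k e u v"
        with 1 step.IH have uv: "u = Suc \<langle>x, xs\<rangle>" "v = Suc \<langle>y, ys\<rangle>" and "?T x y" "?L xs ys" by auto
        then obtain s t ss ts where "x = tm_num s" "y = tm_num t" "(s, t) \<in> cong k e"
          "xs = list_encode (map tm_num ss)" "ys = list_encode (map tm_num ts)"
          "list_all2 (\<lambda>s t. (s, t) \<in> cong k e) ss ts" by blast
        then show "?L u v" unfolding uv by (intro exI[of _ "s # ss"] exI[of _ "t # ts"]) simp
      qed (use 1 in auto)
    next
      case (2 k' f xs e' ys)
      show ?thesis
      proof (intro conjI allI impI)
        fix u v assume "c = tj k e u v"
        with 2 step.IH have uv: "u = \<langle>Suc f, xs\<rangle>" "v = \<langle>Suc f, ys\<rangle>" "code_wf k u" and "?L xs ys" by auto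
        then obtain ss ts where ss: "xs = list_encode (map tm_num ss)" "ys = list_encode (map tm_num ts)"
          "list_all2 (\<lambda>s t. (s, t) \<in> cong k e) ss ts" by blast
        with uv obtain t where t: "t \<in> terms ar k" "tm_num t = tm_num (App f ss)"
          using code_wf_iff[OF assms(1)] by auto
        then have "App f ss \<in> terms ar k" using tm_num_inj by blast
        then have "(App f ss, App f ts) \<in> cong k e"
          using congruence_interp[OF C(1), of f ss ts] ss(3) by (simp add: App_terms)
        then show "?T u v" unfolding uv ss by (intro exI[of _ "App f ss"] exI[of _ "App f ts"]) simp
      qed (use 2 in auto)
    next
      case (3 k' e' x y)
      then show ?thesis using step.IH congruence_sym[OF C(1)] by auto
    next
      case (4 k' e' x y z)
      show ?thesis
      proof (intro conjI allI impI)
        fix u v assume "c = tj k e u v"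
        with 4 step.IH have "?T u y" "?T y v" by auto
        then show "?T u v" using congruence_trans[OF C(1)] tm_num_inj by metis
      qed (use 4 in auto)
    qed
  qed
  then show ?thesis using assms unfolding Eq_def by blast
qed

text \<open>By minimality of \<open>cong k e\<close>, it is enough that derivability is itself a
  congruence containing the relations and the law instances.\<close>

lemma Eq_complete:
  assumes "k \<ge> 1" "(s, t) \<in> cong k e"
  shows "Eq k e (tm_num s) (tm_num t)"
proof -
  let ?\<theta> = "{(s, t) \<in> terms ar k \<times> terms ar k. Eq k e (tm_num s) (tm_num t)}"
  note base = clos.base[of eq_base, where R = eq_step, OF eq_base.intros(1)] clos.base[of eq_base, where R = eq_step, OF eq_base.intros(2)]
    clos.base[of eq_base, where R = eq_step, OF eq_base.intros(3)] clos.base[of eq_base, where R = eq_step, OF eq_base.intros(4)]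
  note step = clos.step[where R = eq_step, OF eq_step.intros(1)]
    clos.step[where R = eq_step, OF eq_step.intros(2)]
    clos.step[where R = eq_step, OF eq_step.intros(3)]
    clos.step[where R = eq_step, OF eq_step.intros(4)]
  have "tcong ar k ?\<theta>"
    unfolding congruence_def
  proof (intro conjI allI ballI impI)
    have "refl_on (terms ar k) ?\<theta>"
      unfolding Eq_def using code_wf_iff[OF assms(1)] by (auto intro!: refl_onI base(1))
    moreover have "sym ?\<theta>" unfolding Eq_def by (auto intro!: symI intro: step(3))
    moreover have "trans ?\<theta>" unfolding Eq_def by (auto intro!: transI intro: step(4))
    ultimately show "equiv (carrier (term_alg ar k)) ?\<theta>" by (auto intro!: equivI)
  next
    fix f xs ys
    assume f: "f < length ar" and xs: "xs \<in> args ar (term_alg ar k) f"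
      and ys: "ys \<in> args ar (term_alg ar k) f" and all: "list_all2 (\<lambda>x y. (x, y) \<in> ?\<theta>) xs ys"
    have mem: "App f xs \<in> terms ar k" "App f ys \<in> terms ar k"
      using f xs ys by (auto simp: args_def App_terms)
    from all have "clos eq_base eq_step
      (lj k e (list_encode (map tm_num xs)) (list_encode (map tm_num ys)))"
    proof (induction rule: list_all2_induct)
      case Nil
      show ?case by (simp add: base(4))
    next
      case (Cons x xs y ys)
      then show ?case by (simp add: step(1) Eq_def)
    qed
    note eq = this
    have "code_wf k (tm_num (App f xs))" using code_wf_iff[OF assms(1)] mem by blast
    then have "Eq k e (tm_num (App f xs)) (tm_num (App f ys))"
      unfolding Eq_def tm_num.simps by (rule step(2)[OF _ eq eq])
    with mem show "(interp (term_alg ar k) f xs, interp (term_alg ar k) f ys) \<in> ?\<theta>" by simp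
  qed
  moreover have "\<delta> k ` W e \<subseteq> ?\<theta>"
  proof safe
    fix s t n assume n: "n \<in> W e" "(s, t) = \<delta> k n"
    with \<delta>_terms[OF assms(1), of n] show "s \<in> terms ar k" "t \<in> terms ar k" by auto
    have "Eq k e (p1 (g \<langle>k, n\<rangle>)) (p2 (g \<langle>k, n\<rangle>))" unfolding Eq_def by (rule base(2)[OF n(1)])
    then show "Eq k e (tm_num s) (tm_num t)"
      by (simp add: g_\<delta>[OF assms(1)] tm_pair_num_def flip: n(2))
  qed
  moreover have "law_instances ar L k \<subseteq> ?\<theta>"
  proof safe
    fix s t assume st: "(s, t) \<in> law_instances ar L k"
    then show "s \<in> terms ar k" "t \<in> terms ar k" using law_instances_terms by blast+
    from st obtain \<sigma> u v where uv: "s = subst \<sigma> u" "t = subst \<sigma> v" "(u, v) \<in> L"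
      and \<sigma>: "\<And>i. \<sigma> i \<in> terms ar k"
      unfolding law_instances_def by blast
    \<comment> \<open>One list has to serve both sides of the law, so it covers the variables of
      both.\<close>
    have "finite (vars u \<union> vars v)" by (simp add: finite_vars)
    then obtain m where m: "\<And>i. i \<in> vars u \<union> vars v \<Longrightarrow> i < m"
      unfolding finite_nat_set_iff_bounded by blast
    define l where "l = list_encode (map (\<lambda>i. tm_num (\<sigma> i)) [0..<m])"
    have "entry l i = tm_num (\<sigma> i)" if "i < m" for i
      using that by (simp add: l_def entry_list_encode)
    then have "Sub k l (tm_num u) (tm_num s)" "Sub k l (tm_num v) (tm_num t)"
      unfolding uv using m \<sigma> by (intro Sub_complete[OF assms(1)]; blast)+
    moreover have "\<langle>tm_num u, tm_num v\<rangle> \<in> W laws"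
      using uv by (force simp: W_laws tm_pair_num_def)
    ultimately show "Eq k e (tm_num s) (tm_num t)" unfolding Eq_def by (intro base(3))
  qed
  ultimately have "cong k e \<subseteq> ?\<theta>" unfolding cong_def by (rule presentation_congruence_least)
  with assms(2) show ?thesis by blast
qed

lemma Eq_iff: "k \<ge> 1 \<Longrightarrow> Eq k e (tm_num s) (tm_num t) \<longleftrightarrow> (s, t) \<in> cong k e"
  using Eq_sound Eq_complete tm_num_inj by metis

lemma semidec_Eq:
  assumes "computable a" "computable b" "computable x" "computable y"
  shows "semidec (\<lambda>z. Eq (a z) (b z) (x z) (y z))"
proof -
  have "semidec eq_base"
    by (rule semidec_cong[OF eq_base.simps])
      (intro semidec_intros computable_intros computable_g_comp semidec_code_wf semidec_Sub)
  moreover have "semidec (\<lambda>z. eq_step (p1 z) (p1 (p2 z)) (p2 (p2 z)))"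
    by (rule semidec_cong[OF eq_step.simps])
      (intro semidec_intros computable_intros semidec_code_wf)
  ultimately have "semidec (clos eq_base eq_step)" by (rule semidec_clos)
  from semidec_comp[OF this computable_judgement(1)[OF assms]] show ?thesis
    unfolding Eq_def .
qed

end

section \<open>The set of finite presentations as a complete isomorphism invariant\<close>

section \<open>The reduction\<close>

context coded_variety
begin

text \<open>Replaces a substitution by a number and surjectivity by \<open>k\<close> derivable
  equations. One way, the first \<open>j\<close> values are listed; the other way,
  \<open>env\<close> turns any list into a substitution.\<close>

lemma generated_by_relations_iff:
  assumes k: "k \<ge> 1" and j: "j \<ge> 1"
  shows "(\<exists>\<sigma>. generated_by ar j (\<delta> j ` S) k (cong k e) \<sigma>) \<longleftrightarrow>
    (\<exists>l. (\<forall>i<k. \<exists>t t'. code_wf j t \<and> Sub k l t t' \<and> Eq k e t' \<langle>0, i\<rangle>) \<and>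
      (\<forall>n\<in>S. \<exists>u v. Sub k l (p1 (g \<langle>j, n\<rangle>)) u \<and> Sub k l (p2 (g \<langle>j, n\<rangle>)) v \<and> Eq k e u v))"
    (is "?L \<longleftrightarrow> ?R")
proof
  assume ?L
  then obtain \<sigma> where \<sigma>: "\<And>i. \<sigma> i \<in> terms ar k"
    and onto: "\<And>t. t \<in> terms ar k \<Longrightarrow> \<exists>u\<in>terms ar j. (subst \<sigma> u, t) \<in> cong k e"
    and rel: "\<And>u v n. n \<in> S \<Longrightarrow> \<delta> j n = (u, v) \<Longrightarrow> (subst \<sigma> u, subst \<sigma> v) \<in> cong k e"
    unfolding generated_by_def by force
  define l where "l = list_encode (map (\<lambda>i. tm_num (\<sigma> i)) [0..<j])"
  have "entry l i = tm_num (\<sigma> i)" if "i < j" for i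
    using that by (simp add: l_def entry_list_encode)
  then have Sub: "Sub k l (tm_num t) (tm_num (subst \<sigma> t))" if "t \<in> terms ar j" for t
    using that \<sigma> wf_tm_vars[of ar "{..<j}" t] by (intro Sub_complete[OF k]) (auto simp: terms_def)
  have "\<exists>t t'. code_wf j t \<and> Sub k l t t' \<and> Eq k e t' \<langle>0, i\<rangle>" if "i < k" for i
  proof -
    have "Var i \<in> terms ar k" using that by (auto simp: terms_def intro: wf_tm.intros)
    with onto obtain u where u: "u \<in> terms ar j" "(subst \<sigma> u, Var i) \<in> cong k e" by blast
    then have "Eq k e (tm_num (subst \<sigma> u)) \<langle>0, i\<rangle>" using Eq_complete[OF k] by fastforce
    with u Sub code_wf_iff[OF j] show ?thesis by blast
  qed
  moreover have "\<exists>u v. Sub k l (p1 (g \<langle>j, n\<rangle>)) u \<and> Sub k l (p2 (g \<langle>j, n\<rangle>)) v \<and> Eq k e u v"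
    if n: "n \<in> S" for n
  proof -
    obtain u v where uv: "\<delta> j n = (u, v)" by (cases "\<delta> j n")
    with \<delta>_terms[OF j, of n] have "u \<in> terms ar j" "v \<in> terms ar j" by auto
    with Sub have "Sub k l (p1 (g \<langle>j, n\<rangle>)) (tm_num (subst \<sigma> u))"
      "Sub k l (p2 (g \<langle>j, n\<rangle>)) (tm_num (subst \<sigma> v))"
      by (simp_all add: g_\<delta>[OF j] tm_pair_num_def uv)
    with Eq_complete[OF k rel[OF n uv]] show ?thesis by blast
  qed
  ultimately show ?R by blast
next
  assume ?R
  then obtain l where gen: "\<And>i. i < k \<Longrightarrow> \<exists>t t'. code_wf j t \<and> Sub k l t t' \<and> Eq k e t' \<langle>0, i\<rangle>"
    and rel: "\<And>n. n \<in> S \<Longrightarrow>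
      \<exists>u v. Sub k l (p1 (g \<langle>j, n\<rangle>)) u \<and> Sub k l (p2 (g \<langle>j, n\<rangle>)) v \<and> Eq k e u v" by blast
  let ?\<sigma> = "env k l"
  have "\<exists>t\<in>terms ar j. (subst ?\<sigma> t, Var i) \<in> cong k e" if "i < k" for i
  proof -
    from gen[OF that] obtain s t' where s: "code_wf j s" "Sub k l s t'" "Eq k e t' \<langle>0, i\<rangle>" by blast
    from s(1) obtain t where "t \<in> terms ar j" "s = tm_num t" unfolding code_wf_iff[OF j] by blast
    with s have t: "t \<in> terms ar j" "Sub k l (tm_num t) t'" "Eq k e t' \<langle>0, i\<rangle>" by simp_all
    then have "Eq k e (tm_num (subst ?\<sigma> t)) (tm_num (Var i))" using Sub_sound[OF k] by simp
    with t show ?thesis using Eq_iff[OF k] by blast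
  qed
  \<comment> \<open>\<open>\<rho> i\<close> writes the \<open>i\<close>-th old generator in the new
    ones; substituting \<open>\<rho>\<close> into a term rewrites it as a whole.\<close>
  then obtain \<rho> where \<rho>: "\<And>i. i < k \<Longrightarrow> \<rho> i \<in> terms ar j"
    "\<And>i. i < k \<Longrightarrow> (subst ?\<sigma> (\<rho> i), Var i) \<in> cong k e" by metis
  have "generated_by ar j (\<delta> j ` S) k (cong k e) ?\<sigma>"
    unfolding generated_by_def
  proof (intro conjI allI ballI)
    show "?\<sigma> i \<in> terms ar k" for i by (rule env_terms[OF k])
  next
    fix t assume t: "t \<in> terms ar k"
    have "subst \<rho> t \<in> terms ar j"
      using t \<rho>(1) wf_subst[of ar "{..<k}" t "{..<j}" \<rho>] by (simp add: terms_def)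
    moreover have "(subst (\<lambda>i. subst ?\<sigma> (\<rho> i)) t, subst Var t) \<in> cong k e"
      using t \<rho>(2) unfolding terms_def by (intro congruence_subst[OF cong(1)[OF k]]) auto
    then have "(subst ?\<sigma> (subst \<rho> t), t) \<in> cong k e" by (simp add: subst_subst)
    ultimately show "\<exists>u\<in>terms ar j. (subst ?\<sigma> u, t) \<in> cong k e" by blast
  next
    fix uv assume "uv \<in> \<delta> j ` S"
    then obtain n where "n \<in> S" "uv = \<delta> j n" by blast
    moreover obtain u v where "uv = (u, v)" by (cases uv)
    ultimately have n: "n \<in> S" "\<delta> j n = (u, v)" "uv = (u, v)" by simp_all
    with rel[OF n(1)] obtain u' v' where
      "Sub k l (tm_num u) u'" "Sub k l (tm_num v) v'" "Eq k e u' v'"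
      by (auto simp: g_\<delta>[OF j] tm_pair_num_def)
    then have "Eq k e (tm_num (subst ?\<sigma> u)) (tm_num (subst ?\<sigma> v))"
      using Sub_sound[OF k] by blast
    with n show "case uv of (u, v) \<Rightarrow> (subst ?\<sigma> u, subst ?\<sigma> v) \<in> cong k e"
      using Eq_iff[OF k] by simp
  qed
  then show ?L by (rule exI[of _ "env k l"])
qed

text \<open>A code \<open>n\<close> stands for \<open>j = p1 n + 1\<close> generators and the finite list of relations with
  length \<open>p1 (p2 n)\<close> and entries coded by \<open>p2 (p2 n)\<close>.\<close>

definition relations :: "nat \<Rightarrow> nat set" where
  "relations n = {entry (p2 (p2 n)) m | m. m < p1 (p2 n)}"

text \<open>\<open>Suc\<close> undoes the shift in \<open>fg_code\<close>, so that every number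
  codes a presentation with at least one generator.\<close>

definition presentations :: "nat \<Rightarrow> nat set" where
  "presentations x = {n. \<exists>\<sigma>. generated_by ar (Suc (p1 n)) (\<delta> (Suc (p1 n)) ` relations n)
     (Suc (p1 x)) (cong (Suc (p1 x)) (p2 x)) \<sigma>}"

lemma relations_finite:
  assumes "finite S"
  obtains n where "p1 n = a" "relations n = S"
proof -
  obtain xs where xs: "set xs = S" using finite_list[OF assms] by blast
  let ?n = "\<langle>a, \<langle>length xs, list_encode xs\<rangle>\<rangle>"
  have "relations ?n = S"
    unfolding relations_def xs[symmetric] set_conv_nth by (force simp: entry_list_encode)
  then show thesis using that[of ?n] by simp
qed

lemma ball_relations:
  "(\<forall>r\<in>relations n. Q r) \<longleftrightarrow> (\<forall>m<p1 (p2 n). Q (entry (p2 (p2 n)) m))"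
  by (auto simp: relations_def)

lemma presentations_index: "\<exists>h. computable h \<and> (\<forall>x. W (h x) = presentations x)"
proof -
  let ?k = "\<lambda>x. Suc (p1 x)"
  let ?P = "\<lambda>x n. \<exists>l. (\<forall>i<?k x. \<exists>t t'. code_wf (?k n) t \<and> Sub (?k x) l t t' \<and> Eq (?k x) (p2 x) t' \<langle>0, i\<rangle>) \<and>
    (\<forall>m<p1 (p2 n). \<exists>u v. Sub (?k x) l (p1 (g \<langle>?k n, entry (p2 (p2 n)) m\<rangle>)) u \<and>
      Sub (?k x) l (p2 (g \<langle>?k n, entry (p2 (p2 n)) m\<rangle>)) v \<and> Eq (?k x) (p2 x) u v)"
  have semidec: "semidec (\<lambda>z. ?P (p1 z) (p2 z))"
    by (intro semidec_intros computable_intros semidec_code_wf semidec_Sub semidec_Eq computable_g_comp)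
  have P: "presentations x = {n. ?P x n}" for x
    unfolding presentations_def by (subst generated_by_relations_iff) (simp_all add: ball_relations)
  show ?thesis
  proof (rule semidec_W_index[where Q = ?P, OF semidec])
    fix h assume h: "computable h" "\<And>x. W (h x) = {n. ?P x n}"
    show ?thesis by (intro exI[of _ h] conjI allI h(1) trans[OF h(2) P[symmetric]])
  qed
qed

lemma chain_condition:
  assumes ACC: "fg_ACC ar L \<delta>" and k: "k \<ge> 1"
  shows "chain_condition ar (law_instances ar L k) k"
  unfolding chain_condition_def
proof (intro allI impI)
  fix \<theta> :: "nat \<Rightarrow> (tm \<times> tm) set"
  assume \<theta>: "\<forall>n. tcong ar k (\<theta> n) \<and> law_instances ar L k \<subseteq> \<theta> n \<and> \<theta> n \<subseteq> \<theta> (Suc n)"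
  \<comment> \<open>The search for a zero of the constant 1 never halts, so \<open>e\<close> is an
    index of the empty set and names the free algebra on \<open>k\<close> generators.\<close>
  define e where "e = prog_num (Mu (Comp Succ Zero))"
  have "W e = {}"
    unfolding W_def e_def by (auto simp del: prog_num.simps elim!: computes_elims)
  then have sub: "cong k e \<subseteq> \<theta> n" for n
    unfolding cong_def using \<theta> by (intro presentation_congruence_least) auto
  have "ACC_alg ar (tquot ar k (cong k e))"
    using ACC k unfolding fg_ACC_def fg_alg_def presented_alg_def cong_def by blast
  then obtain N where "\<And>n. n \<ge> N \<Longrightarrow> \<theta> n = \<theta> N"
    by (rule ACC_quotient[OF _ cong(1)[OF k], of e \<theta>]) (use \<theta> sub in blast)+
  then show "\<exists>N. \<forall>n\<ge>N. \<theta> n = \<theta> N" by blast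
qed

lemma isomorphic_iff_presentations:
  assumes ACC: "fg_ACC ar L \<delta>"
  defines "A \<equiv> \<lambda>x. tquot ar (Suc (p1 x)) (cong (Suc (p1 x)) (p2 x))"
  shows "isomorphic ar (A x) (A y) \<longleftrightarrow> presentations x = presentations y"
proof
  note C = cong(1)[of "Suc _", simplified]
  have sub: "presentations x \<subseteq> presentations y" if iso: "isomorphic ar (A x) (A y)" for x y
  proof
    fix n assume "n \<in> presentations x"
    then obtain \<sigma> where gen: "generated_by ar (Suc (p1 n)) (\<delta> (Suc (p1 n)) ` relations n)
        (Suc (p1 x)) (cong (Suc (p1 x)) (p2 x)) \<sigma>"
      unfolding presentations_def by blast
    have F: "\<delta> (Suc (p1 n)) ` relations n \<subseteq> terms ar (Suc (p1 n)) \<times> terms ar (Suc (p1 n))"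
      by (rule \<delta>_image) simp
    obtain \<tau> where "generated_by ar (Suc (p1 n)) (\<delta> (Suc (p1 n)) ` relations n)
        (Suc (p1 y)) (cong (Suc (p1 y)) (p2 y)) \<tau>"
      by (rule generated_by_isomorphic[OF iso[unfolded A_def] C C F gen])
    then show "n \<in> presentations y" unfolding presentations_def by blast
  qed
  assume iso: "isomorphic ar (A x) (A y)"
  moreover have "isomorphic ar (A y) (A x)"
    using isomorphic_sym[OF iso] tquot_closed[OF C] unfolding A_def by blast
  ultimately show "presentations x = presentations y" using sub by blast
next
  assume eq: "presentations x = presentations y"
  have fp: "\<exists>n. p1 n = p1 x \<and>
      cong (Suc (p1 x)) (p2 x) = presentation_congruence ar L (Suc (p1 x)) (\<delta> (Suc (p1 x)) ` relations n)" for x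
  proof -
    let ?k = "Suc (p1 x)"
    obtain N where N: "presentation_congruence ar L ?k (\<delta> ?k ` (W (p2 x) \<inter> {..<N})) = cong ?k (p2 x)"
      unfolding cong_def
    proof (rule finitely_presented[where d = "\<delta> ?k" and S = "W (p2 x)"])
      show "chain_condition ar (law_instances ar L ?k) ?k" by (rule chain_condition[OF ACC]) simp
    qed (simp_all add: law_instances_terms \<delta>_terms)
    have "finite (W (p2 x) \<inter> {..<N})" by simp
    then obtain n where "p1 n = p1 x" "relations n = W (p2 x) \<inter> {..<N}" by (rule relations_finite)
    with N show ?thesis by metis
  qed
  have self: "n \<in> presentations x" if n: "p1 n = p1 x"
    and c: "cong (Suc (p1 x)) (p2 x) = presentation_congruence ar L (Suc (p1 x)) (\<delta> (Suc (p1 x)) ` relations n)"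
    for n x
  proof -
    let ?k = "Suc (p1 x)"
    have F: "\<delta> ?k ` relations n \<subseteq> terms ar ?k \<times> terms ar ?k" by (rule \<delta>_image) simp
    note C = presentation_congruence[OF F law_instances_terms, folded c]
    \<comment> \<open>The variables generate the algebra. \<open>generated_by\<close> also
      constrains the values outside X_k, where \<open>Var 0\<close> is a term that always
      exists.\<close>
    have "generated_by ar ?k (\<delta> ?k ` relations n) ?k (cong ?k (p2 x)) (\<lambda>i. if i < ?k then Var i else Var 0)"
      unfolding generated_by_def
    proof (intro conjI allI ballI)
      fix i show "(if i < ?k then Var i else Var 0) \<in> terms ar ?k"
        by (auto simp: terms_def intro: wf_tm.intros)
    next
      have id: "subst (\<lambda>i. if i < ?k then Var i else Var 0) t = t" if "t \<in> terms ar ?k" for t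
      proof -
        from that have "vars t \<subseteq> {..<?k}" unfolding terms_def using wf_tm_vars by blast
        then have "subst (\<lambda>i. if i < ?k then Var i else Var 0) t = subst Var t"
          by (intro subst_cong) auto
        then show ?thesis by simp
      qed
      show "\<exists>u\<in>terms ar ?k. (subst (\<lambda>i. if i < ?k then Var i else Var 0) u, t) \<in> cong ?k (p2 x)"
        if "t \<in> terms ar ?k" for t
        using congruence_refl[OF C(1)] that id[OF that] by (intro bexI[of _ t]) simp_all
      show "case uv of (u, v) \<Rightarrow> (subst (\<lambda>i. if i < ?k then Var i else Var 0) u,
          subst (\<lambda>i. if i < ?k then Var i else Var 0) v) \<in> cong ?k (p2 x)"
        if "uv \<in> \<delta> ?k ` relations n" for uv
      proof -
        obtain u v where uv: "uv = (u, v)" by (cases uv)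
        with that have mem: "(u, v) \<in> \<delta> ?k ` relations n" by simp
        from subsetD[OF F mem] have "u \<in> terms ar ?k" "v \<in> terms ar ?k" by simp_all
        with subsetD[OF C(2) mem] uv show ?thesis by (simp add: id)
      qed
    qed
    then show ?thesis unfolding presentations_def by (simp add: n exI)
  qed
  from fp[of x] obtain m where m: "p1 m = p1 x" "cong (Suc (p1 x)) (p2 x) =
      presentation_congruence ar L (Suc (p1 x)) (\<delta> (Suc (p1 x)) ` relations m)" by blast
  from fp[of y] obtain n where n: "p1 n = p1 y" "cong (Suc (p1 y)) (p2 y) =
      presentation_congruence ar L (Suc (p1 y)) (\<delta> (Suc (p1 y)) ` relations n)" by blast
  \<comment> \<open>The finite presentation of each algebra is moved to the set of the other, which
    yields the two tuples.\<close>
  from self[OF m] self[OF n] eq have "m \<in> presentations y" "n \<in> presentations x" by auto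
  then obtain \<sigma> \<tau> where
    "generated_by ar (Suc (p1 x)) (\<delta> (Suc (p1 x)) ` relations m) (Suc (p1 y)) (cong (Suc (p1 y)) (p2 y)) \<sigma>"
    "generated_by ar (Suc (p1 y)) (\<delta> (Suc (p1 y)) ` relations n) (Suc (p1 x)) (cong (Suc (p1 x)) (p2 x)) \<tau>"
    unfolding presentations_def using m(1) n(1) by auto
  then show "isomorphic ar (A x) (A y)"
    unfolding A_def m(2) n(2)
    by (intro isomorphic_if_generated_by[OF chain_condition[OF ACC] law_instances_terms] \<delta>_image) auto
qed

end

theorem theorem4p20:
  fixes ar :: signature
    and L :: "(tm \<times> tm) set"
    and \<delta> :: "nat \<Rightarrow> nat \<Rightarrow> tm \<times> tm"
  assumes "ce_variety ar L"
    and "pair_coding ar \<delta>"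
    and "fg_ACC ar L \<delta>"
  shows "fg_iso ar L \<delta> \<le>\<^sub>c eq_ce"
proof -
  obtain laws where laws: "W laws = tm_pair_num ` L"
    using assms(1) unfolding ce_variety_def ce_def by auto
  obtain g where g: "computable g" "\<forall>k\<ge>1. \<forall>n. g \<langle>k, n\<rangle> = tm_pair_num (\<delta> k n)"
    using assms(2) unfolding pair_coding_def by blast
  interpret coded_variety ar L \<delta> g laws
  proof
    show "\<And>s t. (s, t) \<in> L \<Longrightarrow> wf_tm ar UNIV s \<and> wf_tm ar UNIV t"
      using assms(1) unfolding ce_variety_def by auto
    show "\<And>k. k \<ge> 1 \<Longrightarrow> range (\<delta> k) = terms ar k \<times> terms ar k"
      using assms(2) unfolding pair_coding_def by blast
  qed (use laws g in auto)
  obtain h where h: "computable h" "\<And>x. W (h x) = presentations x"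
    using presentations_index by blast
  have "fg_iso ar L \<delta> x y \<longleftrightarrow> isomorphic ar (fg_alg ar L \<delta> (Suc (p1 x)) (p2 x))
      (fg_alg ar L \<delta> (Suc (p1 y)) (p2 y))" for x y
  proof -
    \<comment> \<open>Each number codes exactly one admissible pair, so the existential quantifiers
      in \<open>fg_iso\<close> have only one choice.\<close>
    have code: "x = fg_code k e \<longleftrightarrow> k = Suc (p1 x) \<and> e = p2 x" if "k \<ge> 1" for x k e
    proof
      assume "x = fg_code k e"
      with that show "k = Suc (p1 x) \<and> e = p2 x" by (simp add: fg_code_def)
    next
      assume "k = Suc (p1 x) \<and> e = p2 x"
      then show "x = fg_code k e" by (simp add: fg_code_def)
    qed
    show ?thesis
    proof
      assume "fg_iso ar L \<delta> x y"
      then show "isomorphic ar (fg_alg ar L \<delta> (Suc (p1 x)) (p2 x)) (fg_alg ar L \<delta> (Suc (p1 y)) (p2 y))"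
        unfolding fg_iso_def using code by metis
    next
      assume "isomorphic ar (fg_alg ar L \<delta> (Suc (p1 x)) (p2 x)) (fg_alg ar L \<delta> (Suc (p1 y)) (p2 y))"
      then show "fg_iso ar L \<delta> x y"
        unfolding fg_iso_def using code[of "Suc _"] by force
    qed
  qed
  then have "fg_iso ar L \<delta> x y \<longleftrightarrow> eq_ce (h x) (h y)" for x y
    unfolding eq_ce_def h(2) isomorphic_iff_presentations[OF assms(3), symmetric]
    by (simp add: fg_alg_def presented_alg_def cong_def)
  with h(1) show ?thesis unfolding computably_reducible_def by blast
qed

end
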